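(* Assume the setting below and suppose every coordinate of the saddle point is subcritical, i.e. $\zeta_j<1$ for every $j\in\mathcal{A}$. Then, as $n\to+\infty$, \[ \mathbb{P}(m \text{ is an } \boldsymbol{\alpha}\text{-winner}) \sim \frac{P(\boldsymbol{\zeta})^n}{\prod_{j\in\mathcal{A}}\big((1-\zeta_j)\,\zeta_j^{\lceil \beta_j n\rceil-1}\big)}\cdot\frac{1}{\sqrt{(2\pi n)^{m-1}\det(\mathcal{H}_K(\boldsymbol{\tau}))}}. \]
   Context: Fix an integer $m\ge 2$ of candidates $\{1,\dots,m\}$ and let $\mathcal{A}=\{1,\dots,m-1\}$ (the adversaries of candidate $m$). There are $n$ voters; each voter independently draws a strict ranking $r$ of the candidates with probability $p_r$, where $p_r>0$ for each of the $m!$ rankings and $\sum_r p_r=1$ (these probabilities do not depend on $n$). For $\mathcal{X}\subseteq\mathcal{A}$, let $p_{\mathcal{X}}$ be the probability that, in a random ranking, the set of adversaries ranked above $m$ is exactly $\mathcal{X}$. The characteristic polynomial is $P(\mathbf{x})=\sum_{\mathcal{X}\subseteq\mathcal{A}} p_{\mathcal{X}}\prod_{j\in\mathcal{X}}x_j$ in $\mathbf{x}=(x_1,\dots,x_{m-1})$. Fix $\boldsymbol{\alpha}\in(0,1)^{m-1}$ and set $\boldsymbol{\beta}=\mathbf{1}-\boldsymbol{\alpha}$. Candidate $m$ is an $\boldsymbol{\alpha}$-winner if for every $j\in\mathcal{A}$, strictly more than $\alpha_j n$ voters rank $m$ above $j$. Let $K(\mathbf{t})=\log P(e^{t_1},\dots,e^{t_{m-1}})$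 for $\mathbf{t}\in\mathbb{R}^{m-1}$ (cumulant generating function); the function $\mathbf{t}\mapsto -K(\mathbf{t})+\boldsymbol{\beta}^T\mathbf{t}$ has a unique maximizer $\boldsymbol{\tau}\in\mathbb{R}^{m-1}$ (the log saddle point), and $\boldsymbol{\zeta}=(e^{\tau_1},\dots,e^{\tau_{m-1}})$ is the saddle point. $\mathcal{H}_K(\boldsymbol{\tau})$ denotes the Hessian matrix of $K$ at $\boldsymbol{\tau}$. *)

theory Defs
  imports Complex_Main "HOL-Analysis.Derivative" "HOL-Library.Landau_Symbols" "Jordan_Normal_Form.Determinant"
begin

text \<open>Candidates are 1..m; a ranking is a list of all candidates, best first.\<close>
definition rankings :: "nat \<Rightarrow> nat list set" where
  "rankings m = {r. distinct r \<and> set r = {1..m}}"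

definition ranked_above :: "nat list \<Rightarrow> nat \<Rightarrow> nat \<Rightarrow> bool" where
  "ranked_above r a b \<longleftrightarrow> (\<exists>i k. i < k \<and> k < length r \<and> r ! i = a \<and> r ! k = b)"

definition adversaries :: "nat \<Rightarrow> nat set" where
  "adversaries m = {1..m - 1}"

definition alpha_winner :: "nat \<Rightarrow> (nat \<Rightarrow> real) \<Rightarrow> nat list list \<Rightarrow> bool" where
  "alpha_winner m \<alpha> vs \<longleftrightarrow>
     (\<forall>j\<in>adversaries m. real (card {i. i < length vs \<and> ranked_above (vs ! i) m j}) > \<alpha> j * real (length vs))"

definition prob_winner :: "nat \<Rightarrow> (nat list \<Rightarrow> real) \<Rightarrow> (nat \<Rightarrow> real) \<Rightarrow> nat \<Rightarrow> real" where
  "prob_winner m p \<alpha> n =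
     (\<Sum>vs\<in>{vs. length vs = n \<and> set vs \<subseteq> rankings m \<and> alpha_winner m \<alpha> vs}. \<Prod>i<n. p (vs ! i))"

definition pX :: "nat \<Rightarrow> (nat list \<Rightarrow> real) \<Rightarrow> nat set \<Rightarrow> real" where
  "pX m p X = (\<Sum>r\<in>{r\<in>rankings m. {j\<in>adversaries m. ranked_above r j m} = X}. p r)"

definition char_poly :: "nat \<Rightarrow> (nat list \<Rightarrow> real) \<Rightarrow> (nat \<Rightarrow> real) \<Rightarrow> real" where
  "char_poly m p x = (\<Sum>X\<in>Pow (adversaries m). pX m p X * (\<Prod>j\<in>X. x j))"

definition cgf :: "nat \<Rightarrow> (nat list \<Rightarrow> real) \<Rightarrow> (nat \<Rightarrow> real) \<Rightarrow> real" where
  "cgf m p t = ln (char_poly m p (\<lambda>j. exp (t j)))"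

text \<open>Partial derivative in coordinate i, and the Hessian matrix of K at t
  (indexed by the adversaries 1..m-1, shifted to 0..m-2).\<close>
definition partial :: "nat \<Rightarrow> ((nat \<Rightarrow> real) \<Rightarrow> real) \<Rightarrow> (nat \<Rightarrow> real) \<Rightarrow> real" where
  "partial i f t = deriv (\<lambda>s. f (t(i := s))) (t i)"

definition hessian :: "nat \<Rightarrow> ((nat \<Rightarrow> real) \<Rightarrow> real) \<Rightarrow> (nat \<Rightarrow> real) \<Rightarrow> real mat" where
  "hessian m f t = mat (m - 1) (m - 1) (\<lambda>(i, j). partial (i + 1) (partial (j + 1) f) t)"

end

theory Submission
  imports "HOL-Probability.Characteristic_Functions" Defs
begin

text \<open>
  Let \<open>S j\<close> be the number of voters ranking \<open>j\<close> above \<open>m\<close> and \<open>k j = \<lceil>\<beta> j * n\<rceil> - 1\<close>; then \<open>m\<close> wins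
  iff \<open>S j \<le> k j\<close> for all \<open>j\<close>. For \<open>0 < z < 1\<close>, the Fourier coefficients of \<open>1 / (1 - z * cis \<theta>)\<close>
  give \<open>of_bool (S \<le> k) = z powi (S - k) / (2 * pi) * (\<integral>\<theta>. cis ((S - k) * \<theta>) / (1 - z * cis \<theta>))\<close> over
  \<open>{-pi..pi}\<close>. Taking the product over \<open>j\<close> with \<open>z = \<zeta> j\<close> and the expectation turns the winning
  probability into one integral of \<open>P (\<zeta> * cis \<theta>) ^ n\<close> over the torus. After normalisation by
  \<open>P \<zeta> ^ n\<close> this is the \<open>n\<close>-th power of the characteristic function of the exponentially tilted
  law, whose mean is \<open>\<beta>\<close> (the saddle point equation) and whose covariance matrix is the Hessian of
  \<open>K\<close>. Substituting \<open>\<theta> = u / sqrt n\<close>, dominated convergence leads to a Gaussian integral.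
\<close>

section \<open>Gaussian integrals of positive definite quadratic forms\<close>

text \<open>The integrand is \<open>sqrt (2 * pi / a)\<close> times the normal density with mean
  \<open>- c\<close> and variance \<open>1 / a\<close>. The shift \<open>c\<close> is what a
  completed square leaves behind when one variable is integrated out.\<close>

lemma nn_integral_gaussian_affine:
  fixes a c :: real
  assumes a: "a > 0"
  shows "(\<integral>\<^sup>+s. ennreal (exp (- (a * (s + c)\<^sup>2) / 2)) \<partial>lborel) = ennreal (sqrt (2 * pi / a))"
proof -
  define \<sigma> where "\<sigma> = 1 / sqrt a"
  have s: "\<sigma> > 0" "\<sigma>\<^sup>2 = 1 / a" using a by (auto simp: \<sigma>_def power_divide)
  have e: "exp (- (a * (s + c)\<^sup>2) / 2) = sqrt (2 * pi / a) * normal_density (- c) \<sigma> s" for s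
    unfolding normal_density_def s(2) using a by (simp add: algebra_simps)
  have "(\<integral>\<^sup>+s. ennreal (normal_density (- c) \<sigma> s) \<partial>lborel) = ennreal 1"
    using s by (subst nn_integral_eq_integral) auto
  then show ?thesis unfolding e
    using a s by (simp add: ennreal_mult' nn_integral_cmult)
qed

abbreviation quad_form :: "'a set \<Rightarrow> ('a \<Rightarrow> 'a \<Rightarrow> real) \<Rightarrow> ('a \<Rightarrow> real) \<Rightarrow> real" where
  "quad_form I A u \<equiv> (\<Sum>i\<in>I. \<Sum>j\<in>I. A i j * u i * u j)"

text \<open>One step of Lagrange's reduction of a quadratic form: only the final square involves
  \<open>u k\<close>, and the form in the other variables has the Schur complement of
  \<open>A k k\<close> as its matrix.\<close>

lemma quad_form_insert_complete_square:
  fixes A :: "'a \<Rightarrow> 'a \<Rightarrow> real"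
  assumes I: "finite I" "k \<notin> I" and a: "A k k \<noteq> 0"
    and sym: "\<And>i. i \<in> I \<Longrightarrow> A i k = A k i"
  shows "quad_form (insert k I) A u =
      quad_form I (\<lambda>i j. A i j - A k i * A k j / A k k) u
      + A k k * (u k + (\<Sum>j\<in>I. A k j * u j) / A k k)\<^sup>2"
proof -
  define s where "s = (\<Sum>j\<in>I. A k j * u j)"
  have 1: "(\<Sum>i\<in>I. A i k * u i * u k) = s * u k"
    unfolding s_def sum_distrib_right by (intro sum.cong) (auto simp: sym)
  have 2: "(\<Sum>j\<in>I. A k j * u k * u j) = s * u k"
    unfolding s_def sum_distrib_right by (intro sum.cong) auto
  have 3: "quad_form I (\<lambda>i j. A i j - A k i * A k j / A k k) u = quad_form I A u - s * s / A k k"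
  proof -
    have "quad_form I (\<lambda>i j. A i j - A k i * A k j / A k k) u
        = quad_form I A u - (\<Sum>i\<in>I. \<Sum>j\<in>I. (A k i * u i) * (A k j * u j)) / A k k"
      unfolding sum_divide_distrib sum_subtractf [symmetric]
      by (intro sum.cong refl) (simp add: algebra_simps)
    then show ?thesis by (simp add: sum_product s_def)
  qed
  have "quad_form (insert k I) A u = A k k * u k * u k + 2 * (s * u k) + quad_form I A u"
    using I by (simp add: sum.distrib 1 2)
  also have "\<dots> = quad_form I A u - s * s / A k k + A k k * (u k + s / A k k)\<^sup>2"
    using a by (simp add: power2_eq_square field_simps)
  finally show ?thesis using 3 by (simp add: s_def)
qed

text \<open>Block elimination of the last column: the matrix factors as \<open>L * B\<close> with
  \<open>L\<close> block upper triangular with identity diagonal blocks, and \<open>B\<close> block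
  lower triangular with diagonal blocks \<open>S\<close> and \<open>A d d\<close>.\<close>

lemma det_schur_complement:
  fixes A :: "nat \<Rightarrow> nat \<Rightarrow> real"
  assumes a: "A d d \<noteq> 0"
  shows "det (mat (Suc d) (Suc d) (\<lambda>(i, j). A i j))
       = det (mat d d (\<lambda>(i, j). A i j - A i d * A d j / A d d)) * A d d"
proof -
  define S where "S = mat d d (\<lambda>(i, j). A i j - A i d * A d j / A d d)"
  define B where "B = four_block_mat S (0\<^sub>m d 1) (mat 1 d (\<lambda>(i, j). A d j)) (mat 1 1 (\<lambda>_. A d d))"
  define L where "L = four_block_mat (1\<^sub>m d) (mat d 1 (\<lambda>(i, j). A i d / A d d)) (0\<^sub>m 1 d) (1\<^sub>m 1 :: real mat)"
  have c: "L \<in> carrier_mat (Suc d) (Suc d)" "B \<in> carrier_mat (Suc d) (Suc d)"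
    by (auto simp: L_def B_def S_def)
  have dL: "det L = 1"
    unfolding L_def by (subst det_four_block_mat_lower_left_zero[where n = d and m = 1]) auto
  have dB: "det B = det S * A d d"
    unfolding B_def by (subst det_four_block_mat_upper_right_zero[where n = d and m = 1])
      (auto simp: S_def det_single)
  have "mat (Suc d) (Suc d) (\<lambda>(i, j). A i j) = L * B"
    unfolding L_def B_def
    apply (subst mult_four_block_mat[where ?nr1.0 = d and ?n1.0 = d and ?n2.0 = 1 and ?nc1.0 = d and ?nc2.0 = 1 and ?nr2.0 = 1])
            apply (auto simp: S_def)
    apply (rule eq_matI)
      apply (auto simp: scalar_prod_def less_Suc_eq a)
    done
  then show ?thesis using det_mult[OF c] dL dB by (simp add: S_def)
qed

text \<open>Induction on the dimension. Integrating out the last variable contributes the factor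
  \<open>sqrt (2 * pi / a)\<close> and leaves the form of the Schur complement, whose determinant is
  the old one divided by \<open>a\<close>. Positivity of the determinant is carried along so that
  the square roots can be combined.\<close>

lemma gaussian_nn_integral_PiM:
  fixes A :: "nat \<Rightarrow> nat \<Rightarrow> real"
  assumes sym: "\<And>i j. i \<in> {1..d} \<Longrightarrow> j \<in> {1..d} \<Longrightarrow> A i j = A j i"
    and pd: "\<And>u. \<exists>i\<in>{1..d}. u i \<noteq> 0 \<Longrightarrow> quad_form {1..d} A u > 0"
  shows "det (mat d d (\<lambda>(i, j). A (i + 1) (j + 1))) > 0 \<and>
    (\<integral>\<^sup>+u. ennreal (exp (- quad_form {1..d} A u / 2)) \<partial>PiM {1..d} (\<lambda>_. lborel))
    = ennreal (sqrt ((2 * pi) ^ d / det (mat d d (\<lambda>(i, j). A (i + 1) (j + 1)))))"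
  using assms
proof (induction d arbitrary: A)
  case 0
  interpret product_sigma_finite "\<lambda>_::nat. lborel :: real measure" ..
  show ?case
    using nn_integral_empty[of "\<lambda>_. 1"]
    by (simp add: det_dim_zero[of "mat 0 0 f" for f :: "_ \<Rightarrow> real"])
next
  case (Suc d)
  interpret product_sigma_finite "\<lambda>_::nat. lborel :: real measure" ..
  let ?k = "Suc d" and ?I = "{1..d}"
  define a where "a = A ?k ?k"
  define A' where "A' = (\<lambda>i j. A i j - A ?k i * A ?k j / a)"
  define D where "D = det (mat d d (\<lambda>(i, j). A' (i + 1) (j + 1)))"
  have ins: "{1..Suc d} = insert ?k ?I" by auto
  have a: "a > 0"
  proof -
    have "0 < quad_form {1..Suc d} A (\<lambda>i. if i = ?k then 1 else 0)"
      by (rule Suc.prems(2)) auto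
    then show ?thesis unfolding ins by (simp add: a_def)
  qed
  have sym: "A i ?k = A ?k i" if "i \<in> ?I" for i using that Suc.prems(1) by auto
  have sq: "quad_form (insert ?k ?I) A u = quad_form ?I A' u + a * (u ?k + (\<Sum>j\<in>?I. A ?k j * u j) / a)\<^sup>2" for u
    unfolding A'_def a_def by (rule quad_form_insert_complete_square) (use a sym in \<open>auto simp: a_def\<close>)
  have "D > 0 \<and> (\<integral>\<^sup>+u. ennreal (exp (- quad_form ?I A' u / 2)) \<partial>PiM ?I (\<lambda>_. lborel)) = ennreal (sqrt ((2 * pi) ^ d / D))"
    unfolding D_def
  proof (rule Suc.IH)
    show "A' i j = A' j i" if "i \<in> ?I" "j \<in> ?I" for i j
      using that Suc.prems(1)[of i j] by (auto simp: A'_def)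
    show "quad_form ?I A' u > 0" if u: "\<exists>i\<in>?I. u i \<noteq> 0" for u
    proof -
      \<comment> \<open>The last coordinate is chosen to make the completed square vanish, so the
        full form at \<open>v\<close> equals the reduced form at \<open>u\<close>.\<close>
      define v where "v = u(?k := - (\<Sum>j\<in>?I. A ?k j * u j) / a)"
      have e: "(\<Sum>j\<in>?I. A ?k j * v j) = (\<Sum>j\<in>?I. A ?k j * u j)"
        by (intro sum.cong) (auto simp: v_def)
      from u obtain i where "i \<in> ?I" "u i \<noteq> 0" by blast
      then have "i \<in> {1..Suc d} \<and> v i \<noteq> 0" by (auto simp: v_def)
      then have "quad_form {1..Suc d} A v > 0" by (intro Suc.prems(2)) blast
      moreover have "quad_form {1..Suc d} A v = quad_form ?I A' v"
        unfolding ins sq e by (simp add: v_def)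
      moreover have "quad_form ?I A' v = quad_form ?I A' u"
        by (intro sum.cong refl) (auto simp: v_def)
      ultimately show ?thesis by simp
    qed
  qed
  then have D: "D > 0" and IH: "(\<integral>\<^sup>+u. ennreal (exp (- quad_form ?I A' u / 2)) \<partial>PiM ?I (\<lambda>_. lborel)) = ennreal (sqrt ((2 * pi) ^ d / D))"
    by auto
  have det: "det (mat (Suc d) (Suc d) (\<lambda>(i, j). A (i + 1) (j + 1))) = D * a"
  proof -
    \<comment> \<open>\<open>det_schur_complement\<close> counts from 0 and takes the first factor
      from the last column, whereas \<open>A'\<close> counts from 1 and takes both factors from the
      last row; symmetry reconciles them.\<close>
    have m: "mat d d (\<lambda>(i, j). A (i + 1) (j + 1) - A (i + 1) (d + 1) * A (d + 1) (j + 1) / A (d + 1) (d + 1))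
       = mat d d (\<lambda>(i, j). A' (i + 1) (j + 1))"
      by (rule eq_matI) (use sym in \<open>auto simp: A'_def a_def\<close>)
    show ?thesis
      using det_schur_complement[of "\<lambda>i j. A (i + 1) (j + 1)" d] a unfolding m
      by (simp add: D_def a_def)
  qed
  have "(\<integral>\<^sup>+u. ennreal (exp (- quad_form {1..Suc d} A u / 2)) \<partial>PiM {1..Suc d} (\<lambda>_. lborel))
      = (\<integral>\<^sup>+u. (\<integral>\<^sup>+s. ennreal (exp (- quad_form (insert ?k ?I) A (u(?k := s)) / 2)) \<partial>lborel) \<partial>PiM ?I (\<lambda>_. lborel))"
    unfolding ins by (rule product_nn_integral_insert) (auto intro!: borel_measurable_sum)
  also have "\<dots> = (\<integral>\<^sup>+u. ennreal (exp (- quad_form ?I A' u / 2)) * ennreal (sqrt (2 * pi / a)) \<partial>PiM ?I (\<lambda>_. lborel))"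
  proof (rule nn_integral_cong)
    fix u :: "nat \<Rightarrow> real"
    define c where "c = (\<Sum>j\<in>?I. A ?k j * u j) / a"
    have 1: "(\<Sum>j\<in>?I. A ?k j * (u(?k := s)) j) / a = c" for s
      unfolding c_def by (intro arg_cong2[where f = "(/)"] sum.cong refl) auto
    have 2: "quad_form ?I A' (u(?k := s)) = quad_form ?I A' u" for s
      by (intro sum.cong refl) auto
    have "exp (- quad_form (insert ?k ?I) A (u(?k := s)) / 2)
        = exp (- quad_form ?I A' u / 2) * exp (- (a * (s + c)\<^sup>2) / 2)" for s
      unfolding sq 1 2 by (simp add: exp_add[symmetric] field_simps)
    then have "(\<integral>\<^sup>+s. ennreal (exp (- quad_form (insert ?k ?I) A (u(?k := s)) / 2)) \<partial>lborel)
        = ennreal (exp (- quad_form ?I A' u / 2)) * (\<integral>\<^sup>+s. ennreal (exp (- (a * (s + c)\<^sup>2) / 2)) \<partial>lborel)"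
      by (simp add: ennreal_mult' nn_integral_cmult)
    then show "(\<integral>\<^sup>+s. ennreal (exp (- quad_form (insert ?k ?I) A (u(?k := s)) / 2)) \<partial>lborel)
        = ennreal (exp (- quad_form ?I A' u / 2)) * ennreal (sqrt (2 * pi / a))"
      using nn_integral_gaussian_affine[OF a] by simp
  qed
  also have "\<dots> = ennreal (sqrt ((2 * pi) ^ d / D)) * ennreal (sqrt (2 * pi / a))"
    unfolding IH[symmetric] by (intro nn_integral_multc) (auto intro!: borel_measurable_sum)
  also have "\<dots> = ennreal (sqrt ((2 * pi) ^ Suc d / (D * a)))"
    using a D by (subst ennreal_mult'[symmetric]) (auto simp: real_sqrt_mult[symmetric] mult_ac)
  finally show ?case using det D a by simp
qed

section \<open>Fourier coefficients of the geometric kernel\<close>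

text \<open>Reverse triangle inequality. For subcritical \<open>z\<close> it keeps the denominator
  of the geometric kernel away from 0, uniformly in the angle.\<close>

lemma norm_one_minus_cis_ge:
  fixes z :: real
  assumes "0 \<le> z"
  shows "1 - z \<le> cmod (1 - of_real z * cis \<theta>)"
  using norm_triangle_ineq2[of 1 "of_real z * cis \<theta>"] assms by (simp add: norm_mult)

text \<open>Orthogonality of the characters of the circle. For \<open>s\<close> nonzero the
  antiderivative takes equal values at both ends, since \<open>cos\<close> is even and
  \<open>sin (s * pi) = 0\<close>.\<close>

lemma has_bochner_integral_cis:
  fixes s :: int
  shows "has_bochner_integral lborel (\<lambda>\<theta>. indicator {-pi..pi} \<theta> *\<^sub>R cis (of_int s * \<theta>))
           (if s = 0 then of_real (2 * pi) else 0)"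
proof (cases "s = 0")
  case True
  have "has_bochner_integral lborel (\<lambda>\<theta>. indicator {-pi..pi} \<theta> *\<^sub>R (1::complex)) ((pi - (-pi)) *\<^sub>R 1)"
    by (rule has_bochner_integral_scaleR_left)
      (use has_bochner_integral_real_indicator[of "{-pi..pi}" lborel] in simp)
  then show ?thesis using True by (simp add: scaleR_conv_of_real)
next
  case False
  define F where "F = (\<lambda>\<theta>. cis (of_int s * \<theta>) / (\<i> * of_int s))"
  have F: "F pi - F (-pi) = 0"
  proof -
    have "cis (of_int s * pi) = cis (of_int s * (-pi))"
      using sin_zero_iff_int2[of "of_int s * pi"] by (auto simp: cis.ctr)
    then show ?thesis by (simp add: F_def)
  qed
  have d: "(F has_vector_derivative cis (of_int s * \<theta>)) (at \<theta> within {-pi..pi})" for \<theta>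
  proof -
    have "((\<lambda>x. exp (\<i> * of_int s * x)) has_field_derivative (\<i> * of_int s * exp (\<i> * of_int s * x))) (at x)" for x :: complex
      by (auto intro!: derivative_eq_intros)
    from DERIV_cdivide[OF this, of "\<i> * of_int s"] False
    have "((\<lambda>x. exp (\<i> * of_int s * x) / (\<i> * of_int s)) has_field_derivative (exp (\<i> * of_int s * of_real \<theta>))) (at (of_real \<theta>))"
      by simp
    from has_vector_derivative_real_field[OF this, of "{-pi..pi}"]
    show ?thesis by (simp add: F_def cis_conv_exp mult.assoc)
  qed
  have "has_bochner_integral lborel (\<lambda>\<theta>. indicator {-pi..pi} \<theta> *\<^sub>R cis (of_int s * \<theta>)) (F pi - F (-pi))"
    by (rule has_bochner_integral_FTC_Icc)
      (use d in \<open>auto intro!: continuous_intros\<close>)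
  then show ?thesis using F False by simp
qed

lemma integrable_cis_geometric:
  fixes z :: real
  assumes "0 \<le> z" "z < 1"
  shows "integrable lborel (\<lambda>\<theta>. indicator {-pi..pi} \<theta> *\<^sub>R (cis (a * \<theta>) / (1 - of_real z * cis \<theta>)))"
proof (rule borel_integrable_compact)
  have "1 - of_real z * cis \<theta> \<noteq> 0" for \<theta>
    using norm_one_minus_cis_ge[OF assms(1), of \<theta>] assms(2) by auto
  then show "continuous_on {-pi..pi} (\<lambda>\<theta>. cis (a * \<theta>) / (1 - of_real z * cis \<theta>))"
    by (intro continuous_intros) auto
qed simp

text \<open>The integral \<open>J s\<close> satisfies \<open>J s - z * J (s + 1) = (if s = 0 then 2 * pi else 0)\<close> and is
  bounded in \<open>s\<close>, so \<open>J s = z ^ k * J (s + k) \<longlongrightarrow> 0\<close> for \<open>s > 0\<close>.\<close>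

lemma integral_cis_geometric:
  fixes z :: real and s :: int
  assumes z: "0 < z" "z < 1"
  shows "(\<integral>\<theta>. indicator {-pi..pi} \<theta> *\<^sub>R (cis (of_int s * \<theta>) / (1 - of_real z * cis \<theta>)) \<partial>lborel)
    = (if s \<le> 0 then of_real (2 * pi * z powi (- s)) else 0)"
proof -
  define J where "J = (\<lambda>s::int. \<integral>\<theta>. indicator {-pi..pi} \<theta> *\<^sub>R (cis (of_int s * \<theta>) / (1 - of_real z * cis \<theta>)) \<partial>lborel)"
  note int = integrable_cis_geometric[of z, OF less_imp_le[OF z(1)] z(2)]
  have nz: "1 - of_real z * cis \<theta> \<noteq> 0" for \<theta>
    using norm_one_minus_cis_ge[of z \<theta>] z by auto
  have rec: "J s = of_real z * J (s + 1) + (if s = 0 then of_real (2 * pi) else 0)" for s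
  proof -
    have "J s - of_real z * J (s + 1)
      = (\<integral>\<theta>. indicator {-pi..pi} \<theta> *\<^sub>R (cis (of_int s * \<theta>) / (1 - of_real z * cis \<theta>))
          - of_real z * (indicator {-pi..pi} \<theta> *\<^sub>R (cis (of_int (s + 1) * \<theta>) / (1 - of_real z * cis \<theta>))) \<partial>lborel)"
      unfolding J_def
      by (subst Bochner_Integration.integral_diff, rule int, rule integrable_mult_right, rule int,
        subst Bochner_Integration.integral_mult_right[OF int]) rule
    also have "\<dots> = (\<integral>\<theta>. indicator {-pi..pi} \<theta> *\<^sub>R cis (of_int s * \<theta>) \<partial>lborel)"
    proof (intro Bochner_Integration.integral_cong refl)
      fix \<theta> :: real
      have "cis (of_int (s + 1) * \<theta>) = cis (of_int s * \<theta>) * cis \<theta>"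
        by (simp add: cis_mult algebra_simps)
      then have "cis (of_int s * \<theta>) / (1 - of_real z * cis \<theta>) - of_real z * (cis (of_int (s + 1) * \<theta>) / (1 - of_real z * cis \<theta>))
         = cis (of_int s * \<theta>) * (1 - of_real z * cis \<theta>) / (1 - of_real z * cis \<theta>)"
        by (simp add: diff_divide_distrib[symmetric] algebra_simps)
      also have "\<dots> = cis (of_int s * \<theta>)" using nz by simp
      finally show "indicator {-pi..pi} \<theta> *\<^sub>R (cis (of_int s * \<theta>) / (1 - of_real z * cis \<theta>))
          - of_real z * (indicator {-pi..pi} \<theta> *\<^sub>R (cis (of_int (s + 1) * \<theta>) / (1 - of_real z * cis \<theta>)))
          = indicator {-pi..pi} \<theta> *\<^sub>R cis (of_int s * \<theta>)"
        by (auto simp: indicator_def)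
    qed
    also have "\<dots> = (if s = 0 then of_real (2 * pi) else 0)"
      using has_bochner_integral_cis[of s] by (rule has_bochner_integral_integral_eq)
    finally show ?thesis by (simp add: algebra_simps)
  qed
  have bound: "cmod (J s) \<le> 2 * pi / (1 - z)" for s
  proof -
    have "cmod (J s) \<le> (\<integral>\<theta>. indicator {-pi..pi} \<theta> *\<^sub>R (1 / (1 - z)) \<partial>lborel)"
      unfolding J_def
    proof (rule Bochner_Integration.integral_norm_bound_integral)
      show "integrable lborel (\<lambda>\<theta>. indicator {-pi..pi} \<theta> *\<^sub>R (1 / (1 - z)))"
        by (rule borel_integrable_compact) auto
      show "cmod (indicator {-pi..pi} \<theta> *\<^sub>R (cis (of_int s * \<theta>) / (1 - of_real z * cis \<theta>)))
          \<le> indicator {-pi..pi} \<theta> *\<^sub>R (1 / (1 - z))" for \<theta>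
        using norm_one_minus_cis_ge[of z \<theta>] z
        by (auto simp: indicator_def norm_divide intro!: divide_left_mono mult_pos_pos)
    qed (rule int)
    then show ?thesis using z by simp
  qed
  have iter: "J s = of_real z ^ k * J (s + int k)" if "s > 0" for s k
  proof (induction k)
    case (Suc k)
    then show ?case using rec[of "s + int k"] that by (simp add: algebra_simps)
  qed simp
  have pos: "J s = 0" if s: "s > 0" for s
  proof -
    have "(\<lambda>k. z ^ k * (2 * pi / (1 - z))) \<longlonglongrightarrow> 0"
      using z by (intro tendsto_mult_left_zero LIMSEQ_realpow_zero) auto
    moreover have "cmod (J s) \<le> z ^ k * (2 * pi / (1 - z))" for k
    proof -
      have "cmod (J s) = z ^ k * cmod (J (s + int k))"
        using z by (subst iter[OF s, of k]) (simp add: norm_mult norm_power)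
      also have "\<dots> \<le> z ^ k * (2 * pi / (1 - z))"
        using z by (intro mult_left_mono bound) auto
      finally show ?thesis .
    qed
    ultimately have "cmod (J s) \<le> 0"
      by (intro LIMSEQ_le_const) auto
    then show ?thesis by simp
  qed
  \<comment> \<open>The inhomogeneous term at \<open>s = 0\<close> gives
    \<open>J 0 = 2 * pi\<close>, because \<open>J 1\<close> vanishes; each step further down
    multiplies by \<open>z\<close>.\<close>
  have neg: "J (- int k) = of_real (2 * pi * z ^ k)" for k
  proof (induction k)
    case 0
    then show ?case using rec[of 0] pos[of 1] by simp
  next
    case (Suc k)
    then show ?case using rec[of "- int (Suc k)"] by simp
  qed
  show ?thesis
  proof (cases "s \<le> 0")
    case True
    then have "s = - int (nat (- s))" by simp
    then show ?thesis using neg[of "nat (- s)"] True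
      by (metis J_def minus_minus power_int_of_nat)
  next
    case False
    then show ?thesis using pos[of s] by (simp add: J_def)
  qed
qed

text \<open>Rescaled by \<open>r\<close> (later \<open>sqrt n\<close>) already in dimension one, so that no change of
  variables is needed in the product space.\<close>

lemma integral_cis_geometric_scaled:
  fixes z r :: real and s :: int
  assumes z: "0 < z" "z < 1" and r: "r > 0"
  shows "integrable lborel (\<lambda>u. indicator {-pi..pi} (u / r) *\<^sub>R (cis (of_int s * (u / r)) / (1 - of_real z * cis (u / r))))"
    "(\<integral>u. indicator {-pi..pi} (u / r) *\<^sub>R (cis (of_int s * (u / r)) / (1 - of_real z * cis (u / r))) \<partial>lborel)
    = (if s \<le> 0 then of_real (2 * pi * r * z powi (- s)) else 0)"
proof -
  define g where "g = (\<lambda>\<theta>. indicator {-pi..pi} \<theta> *\<^sub>R (cis (of_int s * \<theta>) / (1 - of_real z * cis \<theta>)))"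
  have "has_bochner_integral lborel g (if s \<le> 0 then of_real (2 * pi * z powi (- s)) else 0)"
    using integral_cis_geometric[OF z, of s] integrable_cis_geometric[of z "of_int s"] z
    by (auto simp: g_def has_bochner_integral_iff)
  then have "has_bochner_integral lborel (\<lambda>u. g (0 + (1 / r) * u)) ((if s \<le> 0 then of_real (2 * pi * z powi (- s)) else 0) /\<^sub>R \<bar>1 / r\<bar>)"
    using r by (subst lborel_has_bochner_integral_real_affine_iff[symmetric]) auto
  then have h: "has_bochner_integral lborel (\<lambda>u. g (u / r)) (if s \<le> 0 then of_real (2 * pi * r * z powi (- s)) else 0)"
    using r by (auto simp: scaleR_conv_of_real mult_ac split: if_splits)
  from h show "integrable lborel (\<lambda>u. indicator {-pi..pi} (u / r) *\<^sub>R (cis (of_int s * (u / r)) / (1 - of_real z * cis (u / r))))"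
    by (auto simp: has_bochner_integral_iff g_def)
  from h show "(\<integral>u. indicator {-pi..pi} (u / r) *\<^sub>R (cis (of_int s * (u / r)) / (1 - of_real z * cis (u / r))) \<partial>lborel)
    = (if s \<le> 0 then of_real (2 * pi * r * z powi (- s)) else 0)"
    by (auto simp: has_bochner_integral_iff g_def)
qed

section \<open>Characteristic functions of random subsets\<close>

lemma cis_sum: "finite A \<Longrightarrow> cis (\<Sum>x\<in>A. f x) = (\<Prod>x\<in>A. cis (f x))"
  by (induction A rule: finite_induct) (simp_all add: cis_mult[symmetric])

text \<open>Real part of the third-order Taylor estimate for the complex exponential, whose
  remainder is at most \<open>x ^ 4 / 24\<close>.\<close>

lemma cos_le_quartic: "cos (x::real) \<le> 1 - x\<^sup>2 / 2 + x ^ 4 / 24"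
proof -
  have "Re (iexp x - (\<Sum>k\<le>3. (\<i> * x)^k / fact k)) \<le> \<bar>x\<bar> ^ 4 / 24"
    using iexp_approx1[of x 3] complex_Re_le_cmod[of "iexp x - (\<Sum>k\<le>3. (\<i> * x)^k / fact k)"]
    by (simp add: fact_numeral)
  moreover have "Re (\<Sum>k\<le>3. (\<i> * x)^k / fact k) = 1 - x\<^sup>2 / 2"
    by (simp add: eval_nat_numeral fact_numeral)
  moreover have "Re (iexp x) = cos x" by (simp add: cis_conv_exp[symmetric])
  ultimately show ?thesis by simp
qed

lemma norm_one_plus_cis_le:
  assumes "\<bar>\<theta>\<bar> \<le> pi"
  shows "cmod (1 + cis \<theta>) \<le> 2 * (1 - \<theta>\<^sup>2 / 48)"
proof (rule power2_le_imp_le)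
  have "\<theta>\<^sup>2 \<le> (63 / 20)\<^sup>2"
  proof (rule power2_le_iff_abs_le[THEN iffD2])
    \<comment> \<open>\<open>63 / 20\<close> is a rational upper bound for \<open>pi\<close> whose
      square is still below 10. The quartic Taylor term is then at most 5/12 of the squared angle,
      leaving a quadratic coefficient of -1/12 in the bound for \<open>cos\<close>.\<close>
    show "\<bar>\<theta>\<bar> \<le> 63 / 20" using assms pi_approx(2) by simp
  qed simp
  then have t: "\<theta>\<^sup>2 \<le> 10" by (simp add: power2_eq_square)
  then show "0 \<le> 2 * (1 - \<theta>\<^sup>2 / 48)" by simp
  have "\<theta> ^ 4 = \<theta>\<^sup>2 * \<theta>\<^sup>2" by (simp add: eval_nat_numeral)
  also have "\<dots> \<le> 10 * \<theta>\<^sup>2" using t by (intro mult_right_mono) auto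
  finally have "cos \<theta> \<le> 1 - \<theta>\<^sup>2 / 12" using cos_le_quartic[of \<theta>] by simp
  moreover have "(cmod (1 + cis \<theta>))\<^sup>2 = 2 + 2 * cos \<theta>"
    by (simp add: cmod_power2 power2_sum)
  \<comment> \<open>The constant 48 makes the middle term of this square twice the quadratic term in
    the bound for \<open>cos\<close>; the leftover square is nonnegative.\<close>
  moreover have "(2 * (1 - \<theta>\<^sup>2 / 48))\<^sup>2 = 4 - \<theta>\<^sup>2 / 6 + (\<theta>\<^sup>2 / 24)\<^sup>2"
    by (simp add: power2_eq_square algebra_simps)
  ultimately show "(cmod (1 + cis \<theta>))\<^sup>2 \<le> (2 * (1 - \<theta>\<^sup>2 / 48))\<^sup>2"
    using zero_le_power2[of "\<theta>\<^sup>2 / 24"] by linarith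
qed

text \<open>The product is at most each of its factors, hence at most their average. This turns a
  product over coordinates into a bound by the sum over coordinates.\<close>

lemma prod_le_one_minus_average:
  fixes t :: "'a \<Rightarrow> real"
  assumes I: "finite I" "I \<noteq> {}" and t: "\<And>i. i \<in> I \<Longrightarrow> 0 \<le> t i \<and> t i \<le> 1"
  shows "(\<Prod>i\<in>I. 1 - t i) \<le> 1 - (\<Sum>i\<in>I. t i) / card I"
proof -
  have "(\<Prod>i\<in>I. 1 - t i) \<le> 1 - t k" if k: "k \<in> I" for k
  proof -
    have "(\<Prod>i\<in>I. 1 - t i) = (1 - t k) * (\<Prod>i\<in>I - {k}. 1 - t i)"
      using I k by (simp add: prod.remove)
    also have "\<dots> \<le> (1 - t k) * 1"
      using t k by (intro mult_left_mono prod_le_1) auto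
    finally show ?thesis by simp
  qed
  then have "(\<Sum>k\<in>I. (\<Prod>i\<in>I. 1 - t i)) \<le> (\<Sum>k\<in>I. 1 - t k)" by (rule sum_mono)
  moreover have "card I > 0" using I by (simp add: card_gt_0_iff)
  ultimately have "(\<Prod>i\<in>I. 1 - t i) \<le> (card I - (\<Sum>i\<in>I. t i)) / card I"
    by (simp add: sum_subtractf pos_le_divide_eq mult.commute)
  with \<open>card I > 0\<close> show ?thesis by (simp add: diff_divide_distrib)
qed

text \<open>Splitting off the uniform distribution on subsets, whose characteristic function is
  \<open>\<Prod>j\<in>I. (1 + cis (\<theta> j)) / 2\<close>.\<close>

lemma char_fun_subset_bound:
  fixes q :: "'a set \<Rightarrow> real"
  assumes I: "finite I" "I \<noteq> {}" and q: "\<And>X. X \<subseteq> I \<Longrightarrow> q X > 0" and q1: "(\<Sum>X\<in>Pow I. q X) = 1"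
  shows "\<exists>\<kappa>>0. \<forall>\<theta>. (\<forall>j\<in>I. \<bar>\<theta> j\<bar> \<le> pi) \<longrightarrow>
    cmod (\<Sum>X\<in>Pow I. of_real (q X) * cis (\<Sum>j\<in>X. \<theta> j)) \<le> exp (- \<kappa> * (\<Sum>j\<in>I. (\<theta> j)\<^sup>2))"
proof -
  \<comment> \<open>The largest multiple of the counting measure that leaves \<open>q X - c\<close>
    nonnegative; \<open>c * 2 ^ card I\<close> is the weight of the uniform part.\<close>
  define c where "c = Min (q ` Pow I)"
  have fin: "finite (q ` Pow I)" "q ` Pow I \<noteq> {}" using I by auto
  have c: "c > 0" "\<And>X. X \<subseteq> I \<Longrightarrow> c \<le> q X"
    unfolding c_def using q Min_in[OF fin] Min_le[OF fin(1)] by auto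
  \<comment> \<open>Weight of the uniform part, times \<open>1 / 48\<close> from
    \<open>norm_one_plus_cis_le\<close>, times \<open>1 / card I\<close> from averaging the
    factors.\<close>
  define \<kappa> where "\<kappa> = c * 2 ^ card I / (48 * card I)"
  have \<kappa>: "\<kappa> > 0" using I c by (auto simp: \<kappa>_def card_gt_0_iff)
  have "cmod (\<Sum>X\<in>Pow I. of_real (q X) * cis (\<Sum>j\<in>X. \<theta> j)) \<le> exp (- \<kappa> * (\<Sum>j\<in>I. (\<theta> j)\<^sup>2))"
    if \<theta>: "\<forall>j\<in>I. \<bar>\<theta> j\<bar> \<le> pi" for \<theta>
  proof -
    have "(\<Sum>X\<in>Pow I. cis (\<Sum>j\<in>X. \<theta> j)) = (\<Sum>X\<in>Pow I. \<Prod>j\<in>X. cis (\<theta> j))"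
      using I by (intro sum.cong cis_sum) (auto intro: finite_subset)
    also have "\<dots> = (\<Prod>j\<in>I. cis (\<theta> j) + 1)"
      using prod_add[OF I(1), of "\<lambda>j. cis (\<theta> j)" "\<lambda>_. 1"] by simp
    finally have "(\<Sum>X\<in>Pow I. of_real (q X) * cis (\<Sum>j\<in>X. \<theta> j)) =
      (\<Sum>X\<in>Pow I. of_real (q X - c) * cis (\<Sum>j\<in>X. \<theta> j)) + of_real c * (\<Prod>j\<in>I. 1 + cis (\<theta> j))"
      by (simp add: sum_subtractf algebra_simps sum_distrib_left[symmetric])
    also have "cmod \<dots> \<le> (\<Sum>X\<in>Pow I. q X - c) + c * (\<Prod>j\<in>I. cmod (1 + cis (\<theta> j)))"
    proof (rule norm_triangle_mono)
      show "cmod (\<Sum>X\<in>Pow I. of_real (q X - c) * cis (\<Sum>j\<in>X. \<theta> j)) \<le> (\<Sum>X\<in>Pow I. q X - c)"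
        using c by (intro sum_norm_le) (auto simp: norm_mult abs_if simp flip: of_real_diff)
    qed (use c in \<open>simp add: norm_mult prod_norm\<close>)
    also have "(\<Sum>X\<in>Pow I. q X - c) = 1 - c * 2 ^ card I"
      using I by (simp add: sum_subtractf q1 card_Pow)
    also have "(\<Prod>j\<in>I. cmod (1 + cis (\<theta> j))) \<le> (\<Prod>j\<in>I. 2 * (1 - (\<theta> j)\<^sup>2 / 48))"
      using \<theta> norm_one_plus_cis_le by (intro prod_mono conjI norm_ge_zero) blast
    also have "\<dots> = 2 ^ card I * (\<Prod>j\<in>I. 1 - (\<theta> j)\<^sup>2 / 48)"
      by (simp only: prod.distrib prod_constant)
    also have "(\<Prod>j\<in>I. 1 - (\<theta> j)\<^sup>2 / 48) \<le> 1 - (\<Sum>j\<in>I. (\<theta> j)\<^sup>2 / 48) / card I"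
    proof (rule prod_le_one_minus_average[OF I])
      fix j assume "j \<in> I"
      then have "(\<theta> j)\<^sup>2 \<le> 4\<^sup>2"
        using \<theta> pi_less_4 by (intro power2_le_iff_abs_le[THEN iffD2]) force+
      then show "0 \<le> (\<theta> j)\<^sup>2 / 48 \<and> (\<theta> j)\<^sup>2 / 48 \<le> 1" by simp
    qed
    finally have "cmod (\<Sum>X\<in>Pow I. of_real (q X) * cis (\<Sum>j\<in>X. \<theta> j))
      \<le> 1 - c * 2 ^ card I + c * (2 ^ card I * (1 - (\<Sum>j\<in>I. (\<theta> j)\<^sup>2 / 48) / card I))"
      using c by (simp add: mult_left_mono)
    also have "\<dots> = 1 - \<kappa> * (\<Sum>j\<in>I. (\<theta> j)\<^sup>2)"
      by (simp add: \<kappa>_def sum_divide_distrib[symmetric] field_simps)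
    also have "\<dots> \<le> exp (- \<kappa> * (\<Sum>j\<in>I. (\<theta> j)\<^sup>2))"
      using exp_ge_add_one_self[of "- \<kappa> * (\<Sum>j\<in>I. (\<theta> j)\<^sup>2)"] by simp
    finally show ?thesis .
  qed
  with \<kappa> show ?thesis by blast
qed

section \<open>Central limit theorem for finitely supported laws\<close>

lemma cis_approx2: "cmod (cis t - (1 + \<i> * of_real t - of_real (t\<^sup>2 / 2))) \<le> \<bar>t\<bar> ^ 3 / 6"
proof -
  have "(\<Sum>k\<le>2. (\<i> * of_real t)^k / fact k) = 1 + \<i> * of_real t - of_real (t\<^sup>2 / 2)"
    by (simp add: numeral_2_eq_2 fact_numeral power_mult_distrib complex_i_mult_minus)
  with iexp_approx1[of t 2] show ?thesis
    by (simp add: cis_conv_exp fact_numeral)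
qed

text \<open>With mean 0, the characteristic function at scale \<open>1 / sqrt n\<close> differs from
  \<open>1 - v / (2 * n)\<close> by a third-moment term of order \<open>n\<close> to the power -3/2.
  Both have modulus at most 1 for large \<open>n\<close>, so their \<open>n\<close>-th powers differ
  by at most \<open>n\<close> times that, which tends to 0.\<close>

lemma char_fun_power_tendsto:
  fixes q y :: "'a \<Rightarrow> real"
  assumes S: "finite S" and q: "\<And>x. x \<in> S \<Longrightarrow> q x \<ge> 0" and q1: "(\<Sum>x\<in>S. q x) = 1"
    and mean: "(\<Sum>x\<in>S. q x * y x) = 0"
  shows "(\<lambda>n. (\<Sum>x\<in>S. of_real (q x) * cis (y x / sqrt (real n))) ^ n)
    \<longlonglongrightarrow> of_real (exp (- (\<Sum>x\<in>S. q x * (y x)\<^sup>2) / 2))"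
proof -
  define v where "v = (\<Sum>x\<in>S. q x * (y x)\<^sup>2)"
  define C where "C = (\<Sum>x\<in>S. q x * \<bar>y x\<bar> ^ 3) / 6"
  define \<phi> where "\<phi> = (\<lambda>n::nat. \<Sum>x\<in>S. of_real (q x) * cis (y x / sqrt n))"
  define w where "w = (\<lambda>n::nat. 1 + (- v / 2) / real n)"
  have v: "v \<ge> 0" unfolding v_def using q by (intro sum_nonneg) auto
  have \<phi>1: "cmod (\<phi> n) \<le> 1" for n
  proof -
    have "cmod (\<phi> n) \<le> (\<Sum>x\<in>S. q x)"
      unfolding \<phi>_def using q by (intro sum_norm_le) (auto simp: norm_mult)
    then show ?thesis using q1 by simp
  qed
  have diff: "cmod (\<phi> n - of_real (w n)) \<le> C / (sqrt n) ^ 3" if n: "n > 0" for n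
  proof -
    let ?e = "\<lambda>x. y x / sqrt n"
    have w: "of_real (w n) = (\<Sum>x\<in>S. of_real (q x) * (1 + \<i> * of_real (?e x) - of_real ((?e x)\<^sup>2 / 2)))"
    proof -
      have "(\<Sum>x\<in>S. of_real (q x) * (1 + \<i> * of_real (?e x) - of_real ((?e x)\<^sup>2 / 2)))
        = of_real (\<Sum>x\<in>S. q x) + \<i> * of_real ((\<Sum>x\<in>S. q x * y x) / sqrt n) - of_real (v / (2 * n))"
        using n by (simp add: v_def sum_divide_distrib sum_distrib_left sum.distrib sum_subtractf
            algebra_simps power_divide flip: of_real_power)
      then show ?thesis by (simp add: q1 mean w_def)
    qed
    have "cmod (\<phi> n - of_real (w n)) = cmod (\<Sum>x\<in>S. of_real (q x) * (cis (?e x) - (1 + \<i> * of_real (?e x) - of_real ((?e x)\<^sup>2 / 2))))"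
      unfolding \<phi>_def w by (simp only: sum_subtractf right_diff_distrib)
    also have "\<dots> \<le> (\<Sum>x\<in>S. q x * (\<bar>?e x\<bar> ^ 3 / 6))"
    proof (rule sum_norm_le)
      fix x assume x: "x \<in> S"
      have "cmod (cis (?e x) - (1 + \<i> * of_real (?e x) - of_real ((?e x)\<^sup>2 / 2))) \<le> \<bar>?e x\<bar> ^ 3 / 6"
        by (rule cis_approx2)
      then show "cmod (of_real (q x) * (cis (?e x) - (1 + \<i> * of_real (?e x) - of_real ((?e x)\<^sup>2 / 2)))) \<le> q x * (\<bar>?e x\<bar> ^ 3 / 6)"
        using mult_left_mono[OF _ q[OF x]] by (simp only: norm_mult norm_of_real abs_of_nonneg[OF q[OF x]])
    qed
    also have "\<dots> = C / (sqrt n) ^ 3"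
      unfolding C_def by (simp add: sum_divide_distrib power_divide abs_divide mult_ac)
    finally show ?thesis .
  qed
  have lim0: "(\<lambda>n. \<phi> n ^ n - of_real (w n) ^ n) \<longlonglongrightarrow> 0"
  proof (rule Lim_null_comparison)
    show "(\<lambda>n. C / sqrt (real n)) \<longlonglongrightarrow> 0"
      by (intro real_tendsto_divide_at_top[OF tendsto_const]
          filterlim_compose[OF sqrt_at_top] filterlim_real_sequentially)
    show "\<forall>\<^sub>F n in sequentially. cmod (\<phi> n ^ n - of_real (w n) ^ n) \<le> C / sqrt (real n)"
      using eventually_gt_at_top[of 0] eventually_gt_at_top[of "nat \<lceil>v\<rceil>"]
    proof eventually_elim
      fix n :: nat assume n: "0 < n" "nat \<lceil>v\<rceil> < n"
      then have "v \<le> n" by linarith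
      \<comment> \<open>\<open>norm_power_diff\<close> requires both bases in the unit disc;
        \<open>v \<le> n\<close> keeps \<open>w n\<close> between 1/2 and 1.\<close>
      then have "\<bar>w n\<bar> \<le> 1" using v n by (auto simp: w_def field_simps)
      then have "cmod (\<phi> n ^ n - of_real (w n) ^ n) \<le> n * cmod (\<phi> n - of_real (w n))"
        by (intro norm_power_diff \<phi>1) simp
      also have "\<dots> \<le> n * (C / (sqrt n) ^ 3)"
        using diff[of n] n by (intro mult_left_mono) auto
      also have "\<dots> = C / sqrt n"
        using n by (simp add: eval_nat_numeral field_simps)
      finally show "cmod (\<phi> n ^ n - of_real (w n) ^ n) \<le> C / sqrt n" .
    qed
  qed
  have "(\<lambda>n. w n ^ n) \<longlonglongrightarrow> exp (- v / 2)"
    unfolding w_def by (rule tendsto_exp_limit_sequentially)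
  then have "(\<lambda>n. of_real (w n ^ n) :: complex) \<longlonglongrightarrow> of_real (exp (- v / 2))"
    by (rule tendsto_of_real)
  from tendsto_add[OF lim0 this] show ?thesis
    by (simp add: \<phi>_def v_def)
qed

section \<open>The local limit of the Fourier integral\<close>

text \<open>A matrix of second moments is a weighted sum of rank-one matrices, so its form is the
  second moment of a linear functional. This serves both to identify the limiting variance and to
  prove positive definiteness.\<close>

lemma quad_form_covariance:
  fixes q :: "'s \<Rightarrow> real" and x :: "'s \<Rightarrow> 'i \<Rightarrow> real"
  shows "quad_form I (\<lambda>i j. \<Sum>s\<in>S. q s * x s i * x s j) u = (\<Sum>s\<in>S. q s * (\<Sum>i\<in>I. x s i * u i)\<^sup>2)"
proof -
  have "quad_form I (\<lambda>i j. \<Sum>s\<in>S. q s * x s i * x s j) u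
      = (\<Sum>i\<in>I. \<Sum>j\<in>I. \<Sum>s\<in>S. q s * ((x s i * u i) * (x s j * u j)))"
    by (intro sum.cong refl) (simp add: sum_distrib_left sum_distrib_right mult_ac)
  also have "\<dots> = (\<Sum>i\<in>I. \<Sum>s\<in>S. \<Sum>j\<in>I. q s * ((x s i * u i) * (x s j * u j)))"
    by (intro sum.cong refl sum.swap)
  also have "\<dots> = (\<Sum>s\<in>S. \<Sum>i\<in>I. \<Sum>j\<in>I. q s * ((x s i * u i) * (x s j * u j)))"
    by (rule sum.swap)
  also have "\<dots> = (\<Sum>s\<in>S. q s * (\<Sum>i\<in>I. x s i * u i)\<^sup>2)"
    by (simp only: power2_eq_square sum_product) (simp add: sum_distrib_left)
  finally show ?thesis .
qed

lemma integrable_exp_neg_square: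
  assumes "\<kappa> > (0::real)"
  shows "integrable lborel (\<lambda>x::real. exp (- \<kappa> * x\<^sup>2))"
proof (rule integrableI_bounded)
  have "(\<integral>\<^sup>+x. ennreal (norm (exp (- \<kappa> * x\<^sup>2))) \<partial>lborel) = ennreal (sqrt (2 * pi / (2 * \<kappa>)))"
    using nn_integral_gaussian_affine[of "2 * \<kappa>" 0] assms by (simp add: mult.assoc)
  then show "(\<integral>\<^sup>+x. ennreal (norm (exp (- \<kappa> * x\<^sup>2))) \<partial>lborel) < \<infinity>" by simp
qed simp

text \<open>The indicator of one period is built in, so that all integrals run over the whole space
  and the box that grows under rescaling needs no separate treatment.\<close>

definition torus_kernel :: "real \<Rightarrow> int \<Rightarrow> real \<Rightarrow> complex" where
  "torus_kernel z k \<theta> = indicator {-pi..pi} \<theta> *\<^sub>R (cis (- of_int k * \<theta>) / (1 - of_real z * cis \<theta>))"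

lemma torus_kernel_measurable [measurable]: "torus_kernel z k \<in> borel_measurable borel"
  unfolding torus_kernel_def cis_conv_exp by measurable

lemma norm_torus_kernel_le:
  assumes "0 \<le> z" "z < 1"
  shows "cmod (torus_kernel z k \<theta>) \<le> 1 / (1 - z)"
  using norm_one_minus_cis_ge[OF assms(1), of \<theta>] assms
  by (auto simp: torus_kernel_def indicator_def norm_divide intro!: divide_left_mono mult_pos_pos)

text \<open>Each indicator is a one-dimensional integral by
  \<open>integral_cis_geometric_scaled\<close>; the powers \<open>z ^ S\<close>,
  \<open>z powi (k - S)\<close> and \<open>z powi (- k)\<close> cancel. Fubini merges the product
  over \<open>j\<close> into one integral, and linearity moves the finite sum inside.\<close>

lemma tail_prob_integral:
  fixes w :: "'v \<Rightarrow> complex" and S :: "'v \<Rightarrow> 'i \<Rightarrow> nat" and k :: "'i \<Rightarrow> int"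
  assumes V: "finite V" and I: "finite I" and z: "\<And>j. j \<in> I \<Longrightarrow> 0 < z j \<and> z j < 1" and r: "r > 0"
  shows "(\<Sum>v\<in>V. w v * (\<Prod>j\<in>I. of_bool (int (S v j) \<le> k j))) =
    (\<Prod>j\<in>I. of_real (z j powi (- k j) / (2 * pi * r))) *
    (\<integral>u. (\<Sum>v\<in>V. w v * (\<Prod>j\<in>I. (of_real (z j) * cis (u j / r)) ^ S v j)) *
       (\<Prod>j\<in>I. torus_kernel (z j) (k j) (u j / r)) \<partial>PiM I (\<lambda>_. lborel))"
proof -
  interpret product_sigma_finite "\<lambda>_::'i. lborel :: real measure" ..
  \<comment> \<open>The one-dimensional integrand obtained by merging the phase of the
    \<open>S v j\<close>-th power with that of the kernel; the modulus \<open>z j ^ S v j\<close>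
    stays outside.\<close>
  define g where "g = (\<lambda>v j u. indicator {-pi..pi} (u / r) *\<^sub>R
    (cis (of_int (int (S v j) - k j) * (u / r)) / (1 - of_real (z j) * cis (u / r))))"
  note G = integral_cis_geometric_scaled[OF _ _ r]
  have g_int: "integrable lborel (g v j)" if "j \<in> I" for v j
    unfolding g_def using z[OF that] by (intro G) auto
  have g_eq: "of_real (z j powi (- k j) / (2 * pi * r)) * (of_real (z j) ^ S v j * integral\<^sup>L lborel (g v j))
      = of_bool (int (S v j) \<le> k j)" if "j \<in> I" for v j
  proof -
    have "z j powi (- k j) * z j ^ S v j * z j powi (k j - int (S v j)) = 1"
      using z[OF that] by (simp add: power_int_diff power_int_minus)
    then have "of_real (z j powi (- k j) * z j ^ S v j * z j powi (k j - int (S v j))) = (1::complex)"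
      by simp
    moreover have "integral\<^sup>L lborel (g v j) = (if int (S v j) - k j \<le> 0
        then of_real (2 * pi * r * z j powi (- (int (S v j) - k j))) else 0)"
      unfolding g_def using z[OF that] by (intro G) auto
    ultimately show ?thesis using r
      by (auto simp: field_simps)
  qed
  have split: "(of_real (z j) * cis (u / r)) ^ S v j * torus_kernel (z j) (k j) (u / r)
      = of_real (z j) ^ S v j * g v j u" for v j u
  proof -
    have "cis (of_int (int (S v j) - k j) * (u / r)) = cis (u / r) ^ S v j * cis (- of_int (k j) * (u / r))"
      by (simp only: Complex.DeMoivre cis_mult) (simp add: algebra_simps diff_divide_distrib)
    then show ?thesis by (simp add: torus_kernel_def g_def power_mult_distrib mult_ac)
  qed
  have int: "integrable (PiM I (\<lambda>_. lborel)) (\<lambda>u. w v * (\<Prod>j\<in>I. of_real (z j) ^ S v j * g v j (u j)))" for v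
    using I g_int by (intro integrable_mult_right product_integrable_prod) auto
  have "(\<integral>u. (\<Sum>v\<in>V. w v * (\<Prod>j\<in>I. (of_real (z j) * cis (u j / r)) ^ S v j)) *
       (\<Prod>j\<in>I. torus_kernel (z j) (k j) (u j / r)) \<partial>PiM I (\<lambda>_. lborel))
     = (\<integral>u. (\<Sum>v\<in>V. w v * (\<Prod>j\<in>I. of_real (z j) ^ S v j * g v j (u j))) \<partial>PiM I (\<lambda>_. lborel))"
    by (simp add: sum_distrib_right mult.assoc split flip: prod.distrib)
  also have "\<dots> = (\<Sum>v\<in>V. \<integral>u. w v * (\<Prod>j\<in>I. of_real (z j) ^ S v j * g v j (u j)) \<partial>PiM I (\<lambda>_. lborel))"
    by (rule Bochner_Integration.integral_sum) (rule int)
  also have "\<dots> = (\<Sum>v\<in>V. w v * (\<integral>u. (\<Prod>j\<in>I. of_real (z j) ^ S v j * g v j (u j)) \<partial>PiM I (\<lambda>_. lborel)))"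
    by simp
  also have "\<dots> = (\<Sum>v\<in>V. w v * (\<Prod>j\<in>I. of_real (z j) ^ S v j * integral\<^sup>L lborel (g v j)))"
    using I g_int by (subst product_integral_prod) auto
  finally have "(\<integral>u. (\<Sum>v\<in>V. w v * (\<Prod>j\<in>I. (of_real (z j) * cis (u j / r)) ^ S v j)) *
       (\<Prod>j\<in>I. torus_kernel (z j) (k j) (u j / r)) \<partial>PiM I (\<lambda>_. lborel))
     = (\<Sum>v\<in>V. w v * (\<Prod>j\<in>I. of_real (z j) ^ S v j * integral\<^sup>L lborel (g v j)))" .
  note int_eq = this
  have of_bool_eq: "(\<Prod>j\<in>I. of_bool (int (S v j) \<le> k j)) = (\<Prod>j\<in>I. of_real (z j powi (- k j) / (2 * pi * r))) *
      (\<Prod>j\<in>I. of_real (z j) ^ S v j * integral\<^sup>L lborel (g v j))" for v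
    unfolding prod.distrib[symmetric] by (intro prod.cong refl) (rule g_eq[symmetric])
  show ?thesis
    unfolding int_eq of_bool_eq sum_distrib_left by (intro sum.cong refl mult.left_commute)
qed

text \<open>The bounded discrepancies \<open>k n j - n * \<beta> j\<close>
  contribute only the factors \<open>cis ((n * \<beta> j - k n j) * u j / sqrt n) \<longlonglongrightarrow> 1\<close>.\<close>

lemma local_limit_integral:
  fixes q :: "'i set \<Rightarrow> real" and \<beta> z :: "'i \<Rightarrow> real" and k :: "nat \<Rightarrow> 'i \<Rightarrow> int"
  assumes I: "finite I" "I \<noteq> {}" and q: "\<And>X. X \<subseteq> I \<Longrightarrow> q X > 0" and q1: "(\<Sum>X\<in>Pow I. q X) = 1"
    and mean: "\<And>j. j \<in> I \<Longrightarrow> (\<Sum>X\<in>Pow I. q X * of_bool (j \<in> X)) = \<beta> j"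
    and z: "\<And>j. j \<in> I \<Longrightarrow> 0 < z j \<and> z j < 1"
    and k: "\<And>n j. j \<in> I \<Longrightarrow> \<bar>real n * \<beta> j - of_int (k n j)\<bar> \<le> 1"
  defines "A \<equiv> \<lambda>i j. \<Sum>X\<in>Pow I. q X * (of_bool (i \<in> X) - \<beta> i) * (of_bool (j \<in> X) - \<beta> j)"
  shows "(\<lambda>n. \<integral>u. (\<Sum>X\<in>Pow I. of_real (q X) * cis (\<Sum>j\<in>X. u j / sqrt (real n))) ^ n *
       (\<Prod>j\<in>I. torus_kernel (z j) (k n j) (u j / sqrt (real n))) \<partial>PiM I (\<lambda>_. lborel))
    \<longlonglongrightarrow> (\<integral>u. (\<Prod>j\<in>I. of_real (1 / (1 - z j))) * of_real (exp (- quad_form I A u / 2)) \<partial>PiM I (\<lambda>_. lborel))"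
proof -
  interpret product_sigma_finite "\<lambda>_::'i. lborel :: real measure" ..
  let ?M = "PiM I (\<lambda>_. lborel :: real measure)"
  obtain \<kappa> where \<kappa>: "\<kappa> > 0" and bound: "\<And>\<theta>. (\<forall>j\<in>I. \<bar>\<theta> j\<bar> \<le> pi) \<Longrightarrow>
    cmod (\<Sum>X\<in>Pow I. of_real (q X) * cis (\<Sum>j\<in>X. \<theta> j)) \<le> exp (- \<kappa> * (\<Sum>j\<in>I. (\<theta> j)\<^sup>2))"
    using char_fun_subset_bound[of I q, OF I q q1] by blast
  define f where "f = (\<lambda>n u. (\<Sum>X\<in>Pow I. of_real (q X) * cis (\<Sum>j\<in>X. u j / sqrt (real n))) ^ n *
       (\<Prod>j\<in>I. torus_kernel (z j) (k n j) (u j / sqrt (real n))))"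
  define C where "C = (\<Prod>j\<in>I. 1 / (1 - z j))"
  have C: "C > 0" unfolding C_def using z by (intro prod_pos) auto
  have [measurable]: "(\<lambda>u. cis (\<Sum>j\<in>X. u j / sqrt (real n))) \<in> borel_measurable ?M" if "X \<in> Pow I" for X n
  proof -
    have "(\<lambda>u. \<Sum>j\<in>X. u j / sqrt (real n)) \<in> borel_measurable ?M"
      using that by (intro borel_measurable_sum borel_measurable_divide
          measurable_component_singleton[of _ I "\<lambda>_. lborel", simplified]) auto
    then show ?thesis unfolding cis_conv_exp by measurable
  qed
  have meas: "f n \<in> borel_measurable ?M" for n
    unfolding f_def by measurable
  \<comment> \<open>Inside the box the \<open>n\<close>-th power cancels the \<open>1 / n\<close> in
    the exponent and leaves a Gaussian free of \<open>n\<close>; outside, some kernel factor is 0.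
    The index starts at \<open>Suc n\<close>: for \<open>n = 0\<close> division by zero makes every
    rescaled coordinate 0, and no decay remains.\<close>
  have dom: "cmod (f (Suc n) u) \<le> C * (\<Prod>j\<in>I. exp (- \<kappa> * (u j)\<^sup>2))" for n u
  proof (cases "\<forall>j\<in>I. \<bar>u j / sqrt (real (Suc n))\<bar> \<le> pi")
    case True
    let ?N = "Suc n"
    have "cmod (\<Sum>X\<in>Pow I. of_real (q X) * cis (\<Sum>j\<in>X. u j / sqrt (real ?N))) ^ ?N
        \<le> exp (- \<kappa> * (\<Sum>j\<in>I. (u j / sqrt (real ?N))\<^sup>2)) ^ ?N"
      using bound[OF True] by (intro power_mono) auto
    also have "\<dots> = exp (real ?N * (- \<kappa> * (\<Sum>j\<in>I. (u j / sqrt (real ?N))\<^sup>2)))"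
      by (rule exp_of_nat_mult[symmetric])
    also have "real ?N * (- \<kappa> * (\<Sum>j\<in>I. (u j / sqrt (real ?N))\<^sup>2)) = (\<Sum>j\<in>I. - \<kappa> * (u j)\<^sup>2)"
    proof -
      have "(\<Sum>j\<in>I. (u j / sqrt (real ?N))\<^sup>2) = (\<Sum>j\<in>I. (u j)\<^sup>2) / real ?N"
        by (simp add: power_divide sum_divide_distrib)
      then have "real ?N * (- \<kappa> * (\<Sum>j\<in>I. (u j / sqrt (real ?N))\<^sup>2)) = - \<kappa> * (\<Sum>j\<in>I. (u j)\<^sup>2)"
        by simp
      then show ?thesis by (simp only: sum_distrib_left)
    qed
    also have "exp \<dots> = (\<Prod>j\<in>I. exp (- \<kappa> * (u j)\<^sup>2))" using I by (simp add: exp_sum)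
    finally have 1: "cmod (\<Sum>X\<in>Pow I. of_real (q X) * cis (\<Sum>j\<in>X. u j / sqrt (real ?N))) ^ ?N \<le> \<dots>" .
    have 2: "(\<Prod>j\<in>I. cmod (torus_kernel (z j) (k ?N j) (u j / sqrt (real ?N)))) \<le> C"
      unfolding C_def by (intro prod_mono conjI norm_torus_kernel_le norm_ge_zero) (use z in \<open>auto simp: less_imp_le\<close>)
    have "cmod (f ?N u) \<le> (\<Prod>j\<in>I. exp (- \<kappa> * (u j)\<^sup>2)) * C"
      unfolding f_def norm_mult norm_power prod_norm[symmetric]
      by (rule mult_mono[OF 1 2]) (auto intro: prod_nonneg)
    then show ?thesis by (simp add: mult.commute)
  next
    case False
    then obtain j where j: "j \<in> I" "\<not> \<bar>u j / sqrt (real (Suc n))\<bar> \<le> pi" by blast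
    then have "torus_kernel (z j) (k (Suc n) j) (u j / sqrt (real (Suc n))) = 0"
      by (auto simp: torus_kernel_def indicator_def abs_le_iff)
    then have "f (Suc n) u = 0" unfolding f_def using I j(1) by (auto intro!: bexI[of _ j])
    then show ?thesis using C by (auto intro!: mult_nonneg_nonneg prod_nonneg)
  qed
  have lim: "(\<lambda>n. f n u) \<longlonglongrightarrow> (\<Prod>j\<in>I. of_real (1 / (1 - z j))) * of_real (exp (- quad_form I A u / 2))" for u
  proof -
    \<comment> \<open>The linear functional given by \<open>u\<close>, centred by the mean
      \<open>\<beta>\<close>; its variance is the quadratic form of \<open>A\<close>.\<close>
    define y where "y = (\<lambda>X. \<Sum>j\<in>I. (of_bool (j \<in> X) - \<beta> j) * u j)"
    \<comment> \<open>The kernel after absorbing the phase removed by centring: only the discrepancy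
      between \<open>n * \<beta> j\<close> and \<open>k n j\<close> survives in the
      exponent.\<close>
    define h where "h = (\<lambda>n j. indicator {-pi..pi} (u j / sqrt (real n)) *\<^sub>R
      (cis ((real n * \<beta> j - of_int (k n j)) * (u j / sqrt (real n))) / (1 - of_real (z j) * cis (u j / sqrt (real n)))))"
    have to0: "(\<lambda>n. c / sqrt (real n)) \<longlonglongrightarrow> 0" for c :: real
      by (intro real_tendsto_divide_at_top[OF tendsto_const]
          filterlim_compose[OF sqrt_at_top] filterlim_real_sequentially)
    have "(\<Sum>X\<in>Pow I. q X * y X) = (\<Sum>j\<in>I. u j * ((\<Sum>X\<in>Pow I. q X * of_bool (j \<in> X)) - \<beta> j * (\<Sum>X\<in>Pow I. q X)))"
      unfolding y_def sum_distrib_left by (subst sum.swap)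
        (simp add: sum_distrib_left sum_subtractf algebra_simps)
    also have "\<dots> = 0" by (simp add: mean q1)
    finally have y0: "(\<Sum>X\<in>Pow I. q X * y X) = 0" .
    have "(\<lambda>n. (\<Sum>X\<in>Pow I. of_real (q X) * cis (y X / sqrt (real n))) ^ n)
        \<longlonglongrightarrow> of_real (exp (- (\<Sum>X\<in>Pow I. q X * (y X)\<^sup>2) / 2))"
      by (rule char_fun_power_tendsto) (use I q1 y0 in \<open>auto intro: less_imp_le[OF q]\<close>)
    also have "(\<Sum>X\<in>Pow I. q X * (y X)\<^sup>2) = quad_form I A u"
      unfolding A_def y_def by (rule quad_form_covariance[symmetric])
    finally have L1: "(\<lambda>n. (\<Sum>X\<in>Pow I. of_real (q X) * cis (y X / sqrt (real n))) ^ n)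
        \<longlonglongrightarrow> of_real (exp (- quad_form I A u / 2))" .
    have L2: "(\<lambda>n. h n j) \<longlonglongrightarrow> of_real (1 / (1 - z j))" if j: "j \<in> I" for j
    proof -
      define a b where "a = (\<lambda>n. (real n * \<beta> j - of_int (k n j)) * (u j / sqrt (real n)))"
        and "b = (\<lambda>n::nat. u j / sqrt (real n))"
      have b: "b \<longlonglongrightarrow> 0" unfolding b_def by (rule to0)
      have a: "a \<longlonglongrightarrow> 0"
      proof (rule Lim_null_comparison)
        have "norm (a n) \<le> \<bar>b n\<bar>" for n
          unfolding a_def b_def real_norm_def abs_mult
          by (rule mult_left_le_one_le[OF abs_ge_zero abs_ge_zero k[OF j]])
        then show "eventually (\<lambda>n. norm (a n) \<le> \<bar>b n\<bar>) sequentially"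
          by (rule always_eventually[OF allI])
        show "(\<lambda>n. \<bar>b n\<bar>) \<longlonglongrightarrow> 0" using b by (rule tendsto_rabs_zero)
      qed
      have "eventually (\<lambda>n. \<bar>b n\<bar> < pi) sequentially"
        by (rule order_tendstoD(2)[OF tendsto_rabs_zero[OF b] pi_gt_zero])
      then have ev: "eventually (\<lambda>n. cis (a n) / (1 - of_real (z j) * cis (b n)) = h n j) sequentially"
      proof eventually_elim
        fix n assume "\<bar>b n\<bar> < pi"
        then have "b n \<in> {-pi..pi}" by (simp add: abs_less_iff less_imp_le)
        then show "cis (a n) / (1 - of_real (z j) * cis (b n)) = h n j"
          by (simp only: h_def a_def b_def indicator_simps scaleR_one)
      qed
      have c: "(\<lambda>n. cis (x n)) \<longlonglongrightarrow> 1" if "x \<longlonglongrightarrow> 0" for x :: "nat \<Rightarrow> real"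
        using tendsto_cis[OF that] by simp
      have "1 - complex_of_real (z j) * 1 = of_real (1 - z j)" by simp
      moreover have "(of_real (1 - z j) :: complex) \<noteq> 0" using z[OF j] unfolding of_real_eq_0_iff by simp
      ultimately have "1 - complex_of_real (z j) * 1 \<noteq> 0" by metis
      from tendsto_divide[OF c[OF a] tendsto_diff[OF tendsto_const tendsto_mult[OF tendsto_const c[OF b]]] this]
      have "(\<lambda>n. cis (a n) / (1 - of_real (z j) * cis (b n))) \<longlonglongrightarrow> 1 / (1 - of_real (z j) * 1)" .
      from Lim_transform_eventually[OF this ev] show ?thesis by simp
    qed
    have "f n u = (\<Sum>X\<in>Pow I. of_real (q X) * cis (y X / sqrt (real n))) ^ n * (\<Prod>j\<in>I. h n j)" for n
    proof -
      let ?\<theta> = "\<lambda>j. u j / sqrt (real n)"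
      \<comment> \<open>The common phase removed by centring. Its \<open>n\<close>-th power splits
        over the coordinates and is absorbed by the kernels.\<close>
      define b where "b = (\<Sum>j\<in>I. \<beta> j * ?\<theta> j)"
      have "(\<Sum>j\<in>X. ?\<theta> j) = y X / sqrt (real n) + b" if "X \<in> Pow I" for X
      proof -
        have "(\<Sum>j\<in>X. ?\<theta> j) = (\<Sum>j\<in>I. of_bool (j \<in> X) * ?\<theta> j)"
          using that I by (intro sum.mono_neutral_cong_left) auto
        also have "\<dots> = (\<Sum>j\<in>I. (of_bool (j \<in> X) - \<beta> j) * u j / sqrt (real n) + \<beta> j * ?\<theta> j)"
          by (intro sum.cong refl) (simp add: algebra_simps diff_divide_distrib)
        also have "\<dots> = y X / sqrt (real n) + b"
          by (simp only: y_def b_def sum_divide_distrib sum.distrib)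
        finally show ?thesis .
      qed
      then have "(\<Sum>X\<in>Pow I. of_real (q X) * cis (\<Sum>j\<in>X. ?\<theta> j)) = (\<Sum>X\<in>Pow I. of_real (q X) * cis (y X / sqrt (real n))) * cis b"
        unfolding sum_distrib_right by (intro sum.cong refl) (simp add: cis_mult)
      moreover have "cis b ^ n * (\<Prod>j\<in>I. torus_kernel (z j) (k n j) (?\<theta> j)) = (\<Prod>j\<in>I. h n j)"
      proof -
        have "cis b ^ n = cis (\<Sum>j\<in>I. real n * \<beta> j * ?\<theta> j)"
          by (simp add: Complex.DeMoivre b_def sum_distrib_left mult.assoc)
        also have "\<dots> = (\<Prod>j\<in>I. cis (real n * \<beta> j * ?\<theta> j))" using I by (simp only: cis_sum)
        finally have "cis b ^ n * (\<Prod>j\<in>I. torus_kernel (z j) (k n j) (?\<theta> j))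
          = (\<Prod>j\<in>I. cis (real n * \<beta> j * ?\<theta> j) * torus_kernel (z j) (k n j) (?\<theta> j))"
          by (simp only: prod.distrib)
        also have "\<dots> = (\<Prod>j\<in>I. h n j)"
        proof (intro prod.cong refl)
          fix j
          have "cis ((real n * \<beta> j - of_int (k n j)) * ?\<theta> j) = cis (real n * \<beta> j * ?\<theta> j) * cis (- of_int (k n j) * ?\<theta> j)"
            by (simp only: cis_mult) (simp add: algebra_simps)
          then show "cis (real n * \<beta> j * ?\<theta> j) * torus_kernel (z j) (k n j) (?\<theta> j) = h n j"
            by (simp add: torus_kernel_def h_def)
        qed
        finally show ?thesis .
      qed
      ultimately show ?thesis unfolding f_def by (simp add: power_mult_distrib mult.assoc)
    qed
    then show ?thesis
      using tendsto_mult[OF L1 tendsto_prod[of I "\<lambda>j n. h n j", OF L2]] by (simp add: mult.commute)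
  qed
  have "(\<lambda>n. integral\<^sup>L ?M (f (Suc n))) \<longlonglongrightarrow>
      (\<integral>u. (\<Prod>j\<in>I. of_real (1 / (1 - z j))) * of_real (exp (- quad_form I A u / 2)) \<partial>?M)"
  proof (rule integral_dominated_convergence)
    show "integrable ?M (\<lambda>u. C * (\<Prod>j\<in>I. exp (- \<kappa> * (u j)\<^sup>2)))"
      using I \<kappa> by (intro integrable_mult_right product_integrable_prod integrable_exp_neg_square) auto
    show "AE u in ?M. (\<lambda>n. f (Suc n) u) \<longlonglongrightarrow>
        (\<Prod>j\<in>I. of_real (1 / (1 - z j))) * of_real (exp (- quad_form I A u / 2))"
      using lim by (intro AE_I2 LIMSEQ_Suc)
    show "AE u in ?M. cmod (f (Suc n) u) \<le> C * (\<Prod>j\<in>I. exp (- \<kappa> * (u j)\<^sup>2))" for n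
      by (intro AE_I2 dom)
  qed (use meas in \<open>auto intro!: borel_measurable_sum\<close>)
  then show ?thesis unfolding f_def by (rule LIMSEQ_imp_Suc)
qed

section \<open>Rankings and the winning event\<close>

lemma finite_rankings: "finite (rankings m)"
proof (rule finite_subset)
  show "rankings m \<subseteq> {r. set r \<subseteq> {1..m} \<and> length r = m}"
    using distinct_card by (force simp: rankings_def)
qed (rule finite_lists_length_eq, simp)

lemma finite_adversaries [simp]: "finite (adversaries m)"
  by (simp add: adversaries_def)

abbreviation above_set :: "nat \<Rightarrow> nat list \<Rightarrow> nat set" where
  "above_set m r \<equiv> {j \<in> adversaries m. ranked_above r j m}"

text \<open>Groups the rankings by the set placed above \<open>m\<close>. The embedding
  \<open>of_real\<close> allows complex-valued \<open>g\<close>, as the Fourier argument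
  requires.\<close>

lemma sum_pX:
  fixes g :: "nat set \<Rightarrow> 'a::real_algebra_1"
  shows "(\<Sum>X\<in>Pow (adversaries m). of_real (pX m p X) * g X) = (\<Sum>r\<in>rankings m. of_real (p r) * g (above_set m r))"
proof -
  have "(\<Sum>r\<in>rankings m. of_real (p r) * g (above_set m r))
     = (\<Sum>X\<in>Pow (adversaries m). \<Sum>r\<in>{r \<in> rankings m. above_set m r = X}. of_real (p r) * g (above_set m r))"
    by (rule sum.group[symmetric]) (auto simp: finite_rankings)
  also have "\<dots> = (\<Sum>X\<in>Pow (adversaries m). of_real (pX m p X) * g X)"
    by (intro sum.cong refl) (auto simp: pX_def sum_distrib_right)
  finally show ?thesis ..
qed

lemma ranked_above_iff:
  assumes r: "r \<in> rankings m" and "a \<in> {1..m}" "b \<in> {1..m}" "a \<noteq> b"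
  shows "ranked_above r a b \<longleftrightarrow> \<not> ranked_above r b a"
proof -
  have d: "distinct r" "set r = {1..m}" using r by (auto simp: rankings_def)
  obtain i k where "i < length r" "r ! i = a" "k < length r" "r ! k = b"
    using assms d(2) by (metis in_set_conv_nth)
  moreover from this have "ranked_above r a b \<longleftrightarrow> i < k" "ranked_above r b a \<longleftrightarrow> k < i"
    using d(1) unfolding ranked_above_def by (auto simp: nth_eq_iff_index_eq dest: less_trans)
  moreover have "i \<noteq> k" using calculation assms(4) by auto
  ultimately show ?thesis by auto
qed

text \<open>Every \<open>X\<close> is realised by some ranking: list \<open>X\<close> first, then
  \<open>m\<close>, then the remaining adversaries.\<close>

lemma pX_pos:
  assumes m: "m \<ge> 1" and p: "\<forall>r\<in>rankings m. p r > 0" and X: "X \<subseteq> adversaries m"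
  shows "pX m p X > 0"
proof -
  define xs ys where "xs = sorted_list_of_set X" and "ys = sorted_list_of_set (adversaries m - X)"
  have fin: "finite X" using X by (rule finite_subset) simp
  have s: "set xs = X" "set ys = adversaries m - X" "distinct xs" "distinct ys"
    using fin by (auto simp: xs_def ys_def)
  have mn: "m \<notin> adversaries m" using m by (auto simp: adversaries_def)
  define r where "r = xs @ m # ys"
  have d: "distinct r" using s mn X by (auto simp: r_def)
  have r: "r \<in> rankings m"
    using d s X m by (auto simp: rankings_def r_def adversaries_def)
  \<comment> \<open>Distinctness makes the position of \<open>m\<close> unique, so being above
    \<open>m\<close> means having an index inside \<open>xs\<close>.\<close>
  have nth_m: "k = length xs" if "k < length r" "r ! k = m" for k
    using nth_eq_iff_index_eq[OF d that(1), of "length xs"] that(2) by (simp add: r_def)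
  have "ranked_above r j m \<longleftrightarrow> j \<in> X" for j
  proof
    assume "ranked_above r j m"
    then obtain i k where "i < k" "k < length r" "r ! i = j" "r ! k = m"
      by (auto simp: ranked_above_def)
    with nth_m[of k] have "i < length xs" "r ! i = j" by auto
    then show "j \<in> X" using s(1) by (auto simp: r_def nth_append)
  next
    assume "j \<in> X"
    then obtain i where "i < length xs" "xs ! i = j" using s(1) by (metis in_set_conv_nth)
    then show "ranked_above r j m"
      unfolding ranked_above_def
      by (intro exI[of _ i] exI[of _ "length xs"]) (auto simp: r_def nth_append)
  qed
  with X have "above_set m r = X" by auto
  with r have "r \<in> {r \<in> rankings m. above_set m r = X}" by auto
  then have "{r \<in> rankings m. above_set m r = X} \<noteq> {}" by blast
  then show ?thesis unfolding pX_def using p finite_rankings by (intro sum_pos) auto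
qed

lemma sum_lists_prod_nth:
  fixes f :: "'a \<Rightarrow> 'b::comm_semiring_1"
  assumes "finite A"
  shows "(\<Sum>vs\<in>{vs. length vs = n \<and> set vs \<subseteq> A}. \<Prod>i<n. f (vs ! i)) = (\<Sum>a\<in>A. f a) ^ n"
proof (induction n)
  case 0
  have "{vs::'a list. length vs = 0 \<and> set vs \<subseteq> A} = {[]}" by auto
  then show ?case by simp
next
  case (Suc n)
  let ?L = "\<lambda>n. {vs. length vs = n \<and> set vs \<subseteq> A}"
  have e: "?L (Suc n) = (\<lambda>(a, vs). a # vs) ` (A \<times> ?L n)"
    by (auto simp: length_Suc_conv image_iff)
  have inj: "inj_on (\<lambda>(a, vs). a # vs) (A \<times> ?L n)" by (auto simp: inj_on_def)
  have "(\<Sum>vs\<in>?L (Suc n). \<Prod>i<Suc n. f (vs ! i)) = (\<Sum>(a, vs)\<in>A \<times> ?L n. f a * (\<Prod>i<n. f (vs ! i)))"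
    unfolding e by (subst sum.reindex[OF inj]) (auto simp: prod.lessThan_Suc_shift simp del: prod.lessThan_Suc intro!: sum.cong)
  also have "\<dots> = (\<Sum>a\<in>A. f a) * (\<Sum>vs\<in>?L n. \<Prod>i<n. f (vs ! i))"
    by (simp add: sum_product sum.cartesian_product)
  finally show ?case using Suc by simp
qed

section \<open>Counts of voters, the winning event and the joint generating function\<close>

definition above_count :: "nat \<Rightarrow> nat list list \<Rightarrow> nat \<Rightarrow> nat" where
  "above_count m vs j = card {i. i < length vs \<and> ranked_above (vs ! i) j m}"

text \<open>Every voter ranks exactly one of \<open>m\<close> and \<open>j\<close> above the other,
  so the condition says that fewer than \<open>(1 - \<alpha> j) * n\<close> voters prefer
  \<open>j\<close>. The inequality is strict, so for an integer count the threshold is the ceiling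
  minus one, even when the bound is itself an integer.\<close>

lemma alpha_winner_iff:
  assumes m: "m \<ge> 1" and vs: "set vs \<subseteq> rankings m"
  shows "alpha_winner m \<alpha> vs \<longleftrightarrow>
    (\<forall>j\<in>adversaries m. int (above_count m vs j) \<le> \<lceil>(1 - \<alpha> j) * real (length vs)\<rceil> - 1)"
  unfolding alpha_winner_def
proof (intro ball_cong refl)
  fix j assume j: "j \<in> adversaries m"
  let ?A = "{i. i < length vs \<and> ranked_above (vs ! i) m j}"
    and ?B = "{i. i < length vs \<and> ranked_above (vs ! i) j m}"
  have "ranked_above (vs ! i) m j \<longleftrightarrow> \<not> ranked_above (vs ! i) j m" if "i < length vs" for i
    by (rule ranked_above_iff[of _ m]) (use that vs j m in \<open>auto simp: adversaries_def subset_iff\<close>)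
  then have "{..<length vs} = ?A \<union> ?B" "?A \<inter> ?B = {}" by auto
  then have "length vs = card ?A + card ?B"
    by (metis (no_types, lifting) card_Un_disjoint card_lessThan finite_Un finite_lessThan)
  then have "real (length vs) = real (card ?A) + real (above_count m vs j)"
    by (simp add: above_count_def)
  then show "(\<alpha> j * real (length vs) < real (card ?A)) =
      (int (above_count m vs j) \<le> \<lceil>(1 - \<alpha> j) * real (length vs)\<rceil> - 1)"
    using less_ceiling_iff[of "int (above_count m vs j)" "(1 - \<alpha> j) * real (length vs)"]
    by (auto simp: algebra_simps)
qed

lemma prob_winner_eq:
  assumes "m \<ge> 1"
  shows "prob_winner m p \<alpha> n =
    (\<Sum>vs\<in>{vs. length vs = n \<and> set vs \<subseteq> rankings m}.
      (\<Prod>i<n. p (vs ! i)) * (\<Prod>j\<in>adversaries m. of_bool (int (above_count m vs j) \<le> \<lceil>(1 - \<alpha> j) * real n\<rceil> - 1)))"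
  unfolding prob_winner_def
proof (rule sum.mono_neutral_cong_left)
  show "finite {vs. length vs = n \<and> set vs \<subseteq> rankings m}"
    using finite_lists_length_eq[OF finite_rankings, of m n] by (simp add: conj_commute)
qed (use alpha_winner_iff[OF assms] in \<open>auto simp: of_bool_def\<close>)

text \<open>Independence of the voters: the monomial in the counts factors voter by voter, so the
  joint generating function is the \<open>n\<close>-th power of the characteristic polynomial. It is
  evaluated later at complex arguments.\<close>

lemma sum_rankings_power:
  fixes x :: "nat \<Rightarrow> 'a::{real_algebra_1, comm_ring_1}"
  shows "(\<Sum>vs\<in>{vs. length vs = n \<and> set vs \<subseteq> rankings m}.
      of_real (\<Prod>i<n. p (vs ! i)) * (\<Prod>j\<in>adversaries m. x j ^ above_count m vs j))
    = (\<Sum>X\<in>Pow (adversaries m). of_real (pX m p X) * (\<Prod>j\<in>X. x j)) ^ n"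
proof -
  have "(\<Prod>j\<in>adversaries m. x j ^ above_count m vs j) = (\<Prod>i<n. \<Prod>j\<in>above_set m (vs ! i). x j)"
    if "length vs = n" for vs
  proof -
    have "(\<Prod>i<n. \<Prod>j\<in>above_set m (vs ! i). x j)
        = (\<Prod>i<n. \<Prod>j\<in>adversaries m. if ranked_above (vs ! i) j m then x j else 1)"
      by (intro prod.cong refl prod.inter_filter) simp
    also have "\<dots> = (\<Prod>j\<in>adversaries m. \<Prod>i<n. if ranked_above (vs ! i) j m then x j else 1)"
      by (rule prod.swap)
    also have "\<dots> = (\<Prod>j\<in>adversaries m. x j ^ above_count m vs j)"
    proof (intro prod.cong refl)
      fix j
      have "(\<Prod>i<n. if ranked_above (vs ! i) j m then x j else 1)
          = (\<Prod>i\<in>{i \<in> {..<n}. ranked_above (vs ! i) j m}. x j)"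
        by (rule prod.inter_filter[symmetric]) simp
      also have "{i \<in> {..<n}. ranked_above (vs ! i) j m} = {i. i < length vs \<and> ranked_above (vs ! i) j m}"
        using that by auto
      finally show "(\<Prod>i<n. if ranked_above (vs ! i) j m then x j else 1) = x j ^ above_count m vs j"
        by (simp add: above_count_def)
    qed
    finally show ?thesis ..
  qed
  then have "(\<Sum>vs\<in>{vs. length vs = n \<and> set vs \<subseteq> rankings m}.
      of_real (\<Prod>i<n. p (vs ! i)) * (\<Prod>j\<in>adversaries m. x j ^ above_count m vs j))
    = (\<Sum>vs\<in>{vs. length vs = n \<and> set vs \<subseteq> rankings m}.
      \<Prod>i<n. of_real (p (vs ! i)) * (\<Prod>j\<in>above_set m (vs ! i). x j))"
    by (intro sum.cong refl) (auto simp: prod.distrib)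
  also have "\<dots> = (\<Sum>r\<in>rankings m. of_real (p r) * (\<Prod>j\<in>above_set m r. x j)) ^ n"
    by (rule sum_lists_prod_nth[OF finite_rankings])
  also have "\<dots> = (\<Sum>X\<in>Pow (adversaries m). of_real (pX m p X) * (\<Prod>j\<in>X. x j)) ^ n"
    by (simp add: sum_pX)
  finally show ?thesis .
qed

section \<open>Derivatives of the cumulant generating function\<close>

text \<open>Differentiating an exponential sum in coordinate \<open>i\<close>
  restricts the coefficients to the sets containing \<open>i\<close>.\<close>

definition exp_sum :: "nat set \<Rightarrow> (nat set \<Rightarrow> real) \<Rightarrow> (nat \<Rightarrow> real) \<Rightarrow> real" where
  "exp_sum I c t = (\<Sum>X\<in>Pow I. c X * exp (\<Sum>j\<in>X. t j))"

lemma exp_sum_pos: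
  assumes "finite I" "\<And>X. X \<subseteq> I \<Longrightarrow> c X > 0"
  shows "exp_sum I c t > 0"
  unfolding exp_sum_def using assms by (intro sum_pos) auto

lemma exp_sum_has_real_derivative:
  assumes "finite I" "i \<in> I"
  shows "((\<lambda>s. exp_sum I c (t(i := s))) has_real_derivative
    exp_sum I (\<lambda>X. c X * of_bool (i \<in> X)) (t(i := s))) (at s)"
  unfolding exp_sum_def
proof (rule DERIV_sum)
  fix X assume "X \<in> Pow I"
  then have fin: "finite X" using assms finite_subset by blast
  have "((\<lambda>s. \<Sum>j\<in>X. (t(i := s)) j) has_real_derivative (\<Sum>j\<in>X. of_bool (j = i))) (at s)"
    by (rule DERIV_sum) (auto simp: fun_upd_def)
  also have "(\<Sum>j\<in>X. of_bool (j = i)) = (of_bool (i \<in> X) :: real)"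
    using fin by (simp add: of_bool_def)
  finally have "((\<lambda>s. \<Sum>j\<in>X. (t(i := s)) j) has_real_derivative of_bool (i \<in> X)) (at s)" .
  from DERIV_cmult[OF DERIV_chain2[OF DERIV_exp this], of "c X"]
  show "((\<lambda>s. c X * exp (\<Sum>j\<in>X. (t(i := s)) j)) has_real_derivative
      c X * of_bool (i \<in> X) * exp (\<Sum>j\<in>X. (t(i := s)) j)) (at s)"
    by (simp add: mult_ac)
qed

lemma char_poly_exp: "char_poly m p (\<lambda>j. exp (t j)) = exp_sum (adversaries m) (pX m p) t"
  unfolding char_poly_def exp_sum_def
  by (intro sum.cong refl) (simp add: exp_sum finite_subset[OF _ finite_adversaries])

abbreviation (input) restrict_coeff :: "(nat set \<Rightarrow> real) \<Rightarrow> nat \<Rightarrow> nat set \<Rightarrow> real" where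
  "restrict_coeff c i \<equiv> (\<lambda>X. c X * of_bool (i \<in> X))"

context
  fixes m :: nat and p :: "nat list \<Rightarrow> real"
  assumes m: "m \<ge> 1" and p: "\<forall>r\<in>rankings m. p r > 0"
begin


lemma exp_sum_pX_pos: "exp_sum (adversaries m) (pX m p) t > 0"
  by (rule exp_sum_pos) (use pX_pos[OF m p] in auto)

lemma cgf_has_real_derivative:
  assumes "i \<in> adversaries m"
  shows "((\<lambda>s. cgf m p (t(i := s))) has_real_derivative
    exp_sum (adversaries m) (restrict_coeff (pX m p) i) (t(i := s)) / exp_sum (adversaries m) (pX m p) (t(i := s))) (at s)"
  unfolding cgf_def char_poly_exp
  by (rule DERIV_cong[OF DERIV_chain2[OF DERIV_ln exp_sum_has_real_derivative]])
    (use assms exp_sum_pX_pos in \<open>auto simp: field_simps\<close>)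

lemma partial_cgf:
  assumes "i \<in> adversaries m"
  shows "partial i (cgf m p) t = exp_sum (adversaries m) (restrict_coeff (pX m p) i) t / exp_sum (adversaries m) (pX m p) t"
  unfolding partial_def using DERIV_imp_deriv[OF cgf_has_real_derivative[OF assms, of t "t i"]] by simp

text \<open>The quotient rule applied to the first derivative. The result is the covariance of the
  indicators of \<open>i\<close> and \<open>j\<close> under the law tilted by
  \<open>t\<close>.\<close>

lemma partial_partial_cgf:
  assumes i: "i \<in> adversaries m" and j: "j \<in> adversaries m"
  shows "partial i (partial j (cgf m p)) t =
    exp_sum (adversaries m) (restrict_coeff (restrict_coeff (pX m p) j) i) t / exp_sum (adversaries m) (pX m p) t
    - (exp_sum (adversaries m) (restrict_coeff (pX m p) i) t / exp_sum (adversaries m) (pX m p) t) * (exp_sum (adversaries m) (restrict_coeff (pX m p) j) t / exp_sum (adversaries m) (pX m p) t)"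
proof -
  have pos: "exp_sum (adversaries m) (pX m p) t \<noteq> 0" using exp_sum_pX_pos[of t] by simp
  have "((\<lambda>s. exp_sum (adversaries m) (restrict_coeff (pX m p) j) (t(i := s)) / exp_sum (adversaries m) (pX m p) (t(i := s))) has_real_derivative
    (exp_sum (adversaries m) (restrict_coeff (restrict_coeff (pX m p) j) i) (t(i := t i)) * exp_sum (adversaries m) (pX m p) (t(i := t i))
     - exp_sum (adversaries m) (restrict_coeff (pX m p) j) (t(i := t i)) * exp_sum (adversaries m) (restrict_coeff (pX m p) i) (t(i := t i)))
    / (exp_sum (adversaries m) (pX m p) (t(i := t i)) * exp_sum (adversaries m) (pX m p) (t(i := t i)))) (at (t i))"
    by (rule DERIV_divide; (rule exp_sum_has_real_derivative)?) (use i pos in auto)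
  then show ?thesis
    unfolding partial_def[of i] partial_cgf[OF j]
    by (subst DERIV_imp_deriv, assumption) (use pos in \<open>simp add: field_simps\<close>)
qed

text \<open>The first-order condition at the maximiser, varied in one coordinate at a time. It says
  that the tilted law contains \<open>i\<close> with probability \<open>\<beta> i\<close>.\<close>

lemma saddle_point_mean:
  assumes max: "\<forall>t. - cgf m p t + (\<Sum>j\<in>adversaries m. \<beta> j * t j)
                      \<le> - cgf m p \<tau> + (\<Sum>j\<in>adversaries m. \<beta> j * \<tau> j)"
    and i: "i \<in> adversaries m"
  shows "exp_sum (adversaries m) (restrict_coeff (pX m p) i) \<tau> / exp_sum (adversaries m) (pX m p) \<tau> = \<beta> i"
proof -
  have "((\<lambda>s. (\<Sum>j\<in>adversaries m. \<beta> j * (\<tau>(i := s)) j)) has_real_derivative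
      (\<Sum>j\<in>adversaries m. \<beta> j * of_bool (j = i))) (at (\<tau> i))"
    by (rule DERIV_sum) (auto simp: fun_upd_def intro!: derivative_eq_intros)
  also have "(\<Sum>j\<in>adversaries m. \<beta> j * of_bool (j = i)) = \<beta> i"
    using i by (simp add: of_bool_def if_distrib cong: if_cong)
  finally have "((\<lambda>s. - cgf m p (\<tau>(i := s)) + (\<Sum>j\<in>adversaries m. \<beta> j * (\<tau>(i := s)) j)) has_real_derivative
      - (exp_sum (adversaries m) (restrict_coeff (pX m p) i) (\<tau>(i := \<tau> i)) / exp_sum (adversaries m) (pX m p) (\<tau>(i := \<tau> i))) + \<beta> i) (at (\<tau> i))"
    by (intro DERIV_add DERIV_minus cgf_has_real_derivative i)
  then have "- (exp_sum (adversaries m) (restrict_coeff (pX m p) i) (\<tau>(i := \<tau> i)) / exp_sum (adversaries m) (pX m p) (\<tau>(i := \<tau> i))) + \<beta> i = 0"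
  \<comment> \<open>The maximum is global, so any positive radius would do.\<close>
  proof (rule DERIV_local_max[where d = 1])
    show "\<forall>y. \<bar>\<tau> i - y\<bar> < 1 \<longrightarrow>
      - cgf m p (\<tau>(i := y)) + (\<Sum>j\<in>adversaries m. \<beta> j * (\<tau>(i := y)) j)
      \<le> - cgf m p (\<tau>(i := \<tau> i)) + (\<Sum>j\<in>adversaries m. \<beta> j * (\<tau>(i := \<tau> i)) j)"
      using max unfolding fun_upd_triv by blast
  qed simp
  then show ?thesis by simp
qed

end

section \<open>The asymptotics\<close>

text \<open>All weights are positive, so the form could vanish only if the linear functional were 0
  on every subset. But its values at \<open>{i}\<close> and at the empty set differ by
  \<open>u i\<close>.\<close>

lemma covariance_pos_def:
  fixes q :: "'i set \<Rightarrow> real" and \<beta> u :: "'i \<Rightarrow> real"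
  assumes I: "finite I" and q: "\<And>X. X \<subseteq> I \<Longrightarrow> q X > 0" and u: "\<exists>i\<in>I. u i \<noteq> 0"
  shows "quad_form I (\<lambda>i j. \<Sum>X\<in>Pow I. q X * (of_bool (i \<in> X) - \<beta> i) * (of_bool (j \<in> X) - \<beta> j)) u > 0"
proof -
  define y where "y = (\<lambda>X. \<Sum>i\<in>I. (of_bool (i \<in> X) - \<beta> i) * u i)"
  from u obtain i where i: "i \<in> I" "u i \<noteq> 0" by blast
  have "y {i} - y {} = (\<Sum>j\<in>I. of_bool (j = i) * u j)"
    by (simp add: y_def algebra_simps flip: sum_subtractf)
  also have "\<dots> = u i" using I i by (simp add: of_bool_def if_distrib[of "\<lambda>c. c * _"] cong: if_cong)
  finally have "y {i} - y {} \<noteq> 0" using i by simp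
  then obtain X where X: "X \<in> Pow I" "y X \<noteq> 0" using i by (metis Pow_iff diff_0_right empty_subsetI insert_subset)
  have "(\<Sum>X\<in>Pow I. q X * (y X)\<^sup>2) > 0"
    by (rule sum_pos2[of _ X]) (use I q X in \<open>auto simp: less_imp_le\<close>)
  then show ?thesis unfolding quad_form_covariance y_def .
qed

theorem theorem1:
  fixes m :: nat and p :: "nat list \<Rightarrow> real" and \<alpha> \<beta> \<tau> \<zeta> :: "nat \<Rightarrow> real"
  assumes m2: "m \<ge> 2"
    and p_pos: "\<forall>r\<in>rankings m. p r > 0"
    and p_sum: "(\<Sum>r\<in>rankings m. p r) = 1"
    and alpha: "\<forall>j\<in>adversaries m. 0 < \<alpha> j \<and> \<alpha> j < 1"
    and beta_def: "\<beta> = (\<lambda>j. 1 - \<alpha> j)"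
    and tau_max: "\<forall>t. - cgf m p t + (\<Sum>j\<in>adversaries m. \<beta> j * t j)
                      \<le> - cgf m p \<tau> + (\<Sum>j\<in>adversaries m. \<beta> j * \<tau> j)"
    and zeta_def: "\<zeta> = (\<lambda>j. exp (\<tau> j))"
    and subcrit: "\<forall>j\<in>adversaries m. \<zeta> j < 1"
  shows "(\<lambda>n. prob_winner m p \<alpha> n) \<sim>[at_top]
    (\<lambda>n. char_poly m p \<zeta> ^ n
          / (\<Prod>j\<in>adversaries m. (1 - \<zeta> j) * \<zeta> j powi (\<lceil>\<beta> j * real n\<rceil> - 1))
          * (1 / sqrt ((2 * pi * real n) ^ (m - 1) * det (hessian m (cgf m p) \<tau>))))"
proof -
  define I d where "I = adversaries m" and "d = m - 1"
  have I: "finite I" "I \<noteq> {}" "card I = d" and I_eq: "I = {1..d}"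
    using m2 by (auto simp: I_def d_def adversaries_def)
  have m1: "m \<ge> 1" using m2 by simp
  have z: "0 < \<zeta> j \<and> \<zeta> j < 1" if "j \<in> I" for j
    using that subcrit by (simp add: zeta_def I_def)
  define P where "P = char_poly m p \<zeta>"
  have P_eq: "P = exp_sum I (pX m p) \<tau>"
    unfolding P_def zeta_def I_def by (rule char_poly_exp)
  have P: "P > 0" unfolding P_eq I_def by (rule exp_sum_pX_pos[OF m1 p_pos])
  \<comment> \<open>The exponentially tilted law of the set above \<open>m\<close>; dividing by
    \<open>P\<close> normalises it.\<close>
  define q where "q = (\<lambda>X. pX m p X * exp (\<Sum>j\<in>X. \<tau> j) / P)"
  define A where "A = (\<lambda>i j. \<Sum>X\<in>Pow I. q X * (of_bool (i \<in> X) - \<beta> i) * (of_bool (j \<in> X) - \<beta> j))"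
  define k where "k = (\<lambda>n j. \<lceil>\<beta> j * real n\<rceil> - 1)"
  have q: "q X > 0" if "X \<subseteq> I" for X
    using pX_pos[OF m1 p_pos, of X] that P by (simp add: q_def I_def)
  have q_sum: "(\<Sum>X\<in>Pow I. q X * c X) = exp_sum I (\<lambda>X. pX m p X * c X) \<tau> / P" for c
    unfolding q_def exp_sum_def sum_divide_distrib by (intro sum.cong refl) simp
  have q1: "(\<Sum>X\<in>Pow I. q X) = 1"
    using q_sum[of "\<lambda>_. 1"] P by (simp add: P_eq)
  have mean: "(\<Sum>X\<in>Pow I. q X * of_bool (j \<in> X)) = \<beta> j" if "j \<in> I" for j
    using saddle_point_mean[OF m1 p_pos tau_max] that unfolding q_sum P_eq by (simp add: I_def)
  \<comment> \<open>Expanding the centred products and inserting the means \<open>\<beta>\<close>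
    leaves the mixed moment minus the product of means, which is the second derivative of the
    cumulant generating function.\<close>
  have A_hess: "A i j = partial i (partial j (cgf m p)) \<tau>" if ij: "i \<in> I" "j \<in> I" for i j
  proof -
    have "A i j = (\<Sum>X\<in>Pow I. q X * (of_bool (j \<in> X) * of_bool (i \<in> X)))
        - \<beta> i * (\<Sum>X\<in>Pow I. q X * of_bool (j \<in> X)) - \<beta> j * (\<Sum>X\<in>Pow I. q X * of_bool (i \<in> X))
        + \<beta> i * \<beta> j * (\<Sum>X\<in>Pow I. q X)"
      by (simp only: A_def sum_distrib_left flip: sum_subtractf sum.distrib) (intro sum.cong refl, simp only: algebra_simps)
    also have "\<dots> = (\<Sum>X\<in>Pow I. q X * (of_bool (j \<in> X) * of_bool (i \<in> X))) - \<beta> i * \<beta> j"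
      using ij by (simp add: mean q1)
    also have "\<dots> = partial i (partial j (cgf m p)) \<tau>"
      using ij partial_partial_cgf[OF m1 p_pos, of i j \<tau>] mean[OF ij(1)] mean[OF ij(2)]
      unfolding q_sum P_eq by (simp only: I_def mult.assoc)
    finally show ?thesis .
  qed
  define D where "D = det (hessian m (cgf m p) \<tau>)"
  have D_eq: "D = det (mat d d (\<lambda>(i, j). A (i + 1) (j + 1)))"
    unfolding D_def hessian_def d_def[symmetric]
    by (intro arg_cong[where f = det] eq_matI) (auto simp: A_hess I_eq)
  have gauss: "D > 0 \<and> (\<integral>\<^sup>+u. ennreal (exp (- quad_form I A u / 2)) \<partial>PiM I (\<lambda>_. lborel)) = ennreal (sqrt ((2 * pi) ^ d / D))"
    unfolding D_eq I_eq
  proof (rule gaussian_nn_integral_PiM)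
    show "A i j = A j i" for i j unfolding A_def by (intro sum.cong refl) (simp add: mult_ac)
    show "quad_form {1..d} A u > 0" if "\<exists>i\<in>{1..d}. u i \<noteq> 0" for u
      unfolding A_def I_eq[symmetric] by (rule covariance_pos_def) (use I q that I_eq in auto)
  qed
  then have D: "D > 0" by simp
  have "has_bochner_integral (PiM I (\<lambda>_. lborel)) (\<lambda>u. exp (- quad_form I A u / 2)) (sqrt ((2 * pi) ^ d / D))"
    using gauss by (intro has_bochner_integral_nn_integral) (auto intro!: borel_measurable_sum)
  then have gauss': "(\<integral>u. exp (- quad_form I A u / 2) \<partial>PiM I (\<lambda>_. lborel)) = sqrt ((2 * pi) ^ d / D)"
    by (rule has_bochner_integral_integral_eq)

  define L where "L = (\<lambda>n. \<integral>u. (\<Sum>X\<in>Pow I. of_real (q X) * cis (\<Sum>j\<in>X. u j / sqrt (real n))) ^ n *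
       (\<Prod>j\<in>I. torus_kernel (\<zeta> j) (k n j) (u j / sqrt (real n))) \<partial>PiM I (\<lambda>_. lborel))"
  define Z where "Z = (\<Prod>j\<in>I. 1 - \<zeta> j)"
  \<comment> \<open>The limit of \<open>L\<close>: the kernels at angle 0 contribute
    \<open>1 / Z\<close>, the tilted characteristic function the Gaussian integral. Positivity of
    \<open>l\<close> permits dividing by it below.\<close>
  define l where "l = 1 / Z * sqrt ((2 * pi) ^ d / D)"
  have Z: "Z > 0" unfolding Z_def using z by (intro prod_pos) auto
  have l: "l > 0" using Z D by (simp add: l_def)
  have "L \<longlonglongrightarrow> (\<integral>u. (\<Prod>j\<in>I. of_real (1 / (1 - \<zeta> j))) * of_real (exp (- quad_form I A u / 2)) \<partial>PiM I (\<lambda>_. lborel))"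
    unfolding L_def A_def
  proof (rule local_limit_integral[OF I(1,2) q q1 mean z])
    show "\<bar>real n * \<beta> j - real_of_int (k n j)\<bar> \<le> 1" for n j
      using ceiling_correct[of "\<beta> j * real n"] by (simp add: k_def mult.commute)
  qed
  also have "(\<integral>u. (\<Prod>j\<in>I. of_real (1 / (1 - \<zeta> j))) * of_real (exp (- quad_form I A u / 2)) \<partial>PiM I (\<lambda>_. lborel)) = complex_of_real l"
  proof -
    have "(\<Prod>j\<in>I. complex_of_real (1 / (1 - \<zeta> j))) = of_real (1 / Z)"
      by (simp add: Z_def prod_dividef)
    then show ?thesis
      by (simp only: integral_mult_right_zero integral_complex_of_real gauss' l_def of_real_mult)
  qed
  finally have L_lim: "L \<longlonglongrightarrow> complex_of_real l" .

  define R where "R = (\<lambda>n. char_poly m p \<zeta> ^ n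
          / (\<Prod>j\<in>adversaries m. (1 - \<zeta> j) * \<zeta> j powi (\<lceil>\<beta> j * real n\<rceil> - 1))
          * (1 / sqrt ((2 * pi * real n) ^ (m - 1) * det (hessian m (cgf m p) \<tau>))))"
  \<comment> \<open>An exact identity rather than an estimate: all asymptotic content lies in the
    convergence of \<open>L\<close>. It is stated over the complex numbers because \<open>L\<close>
    is a complex integral.\<close>
  have ratio: "complex_of_real (prob_winner m p \<alpha> n / R n) = L n / of_real l" if n: "n > 0" for n
  proof -
    have of_real_of_bool: "complex_of_real (of_bool b) = of_bool b" for b by (cases b) auto
    define r where "r = sqrt (real n)"
    have r: "r > 0" "r * r = real n" using n by (auto simp: r_def)
    define W where "W = (\<Prod>j\<in>I. \<zeta> j powi (k n j))"
    have W: "W > 0" unfolding W_def using z by (intro prod_pos) (auto simp: zero_less_power_int)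
    have "complex_of_real (prob_winner m p \<alpha> n) = (\<Sum>vs\<in>{vs. length vs = n \<and> set vs \<subseteq> rankings m}.
      of_real (\<Prod>i<n. p (vs ! i)) * (\<Prod>j\<in>I. of_bool (int (above_count m vs j) \<le> k n j)))"
      unfolding prob_winner_eq[OF m1] I_def k_def beta_def by (simp add: of_real_of_bool)
    also have "\<dots> = (\<Prod>j\<in>I. of_real (\<zeta> j powi (- k n j) / (2 * pi * r))) *
      (\<integral>u. (\<Sum>vs\<in>{vs. length vs = n \<and> set vs \<subseteq> rankings m}.
          of_real (\<Prod>i<n. p (vs ! i)) * (\<Prod>j\<in>I. (of_real (\<zeta> j) * cis (u j / r)) ^ above_count m vs j)) *
       (\<Prod>j\<in>I. torus_kernel (\<zeta> j) (k n j) (u j / r)) \<partial>PiM I (\<lambda>_. lborel))"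
    proof (rule tail_prob_integral)
      show "finite {vs. length vs = n \<and> set vs \<subseteq> rankings m}"
        using finite_lists_length_eq[OF finite_rankings, of m n] by (simp add: conj_commute)
    qed (use I z r in auto)
    \<comment> \<open>The generating function on the torus of radii \<open>\<zeta>\<close> is the
      \<open>n\<close>-th power of \<open>P\<close> times the characteristic function of the tilted
      law.\<close>
    also have "(\<lambda>u. \<Sum>vs\<in>{vs. length vs = n \<and> set vs \<subseteq> rankings m}.
          of_real (\<Prod>i<n. p (vs ! i)) * (\<Prod>j\<in>I. (of_real (\<zeta> j) * cis (u j / r)) ^ above_count m vs j))
       = (\<lambda>u. of_real (P ^ n) * (\<Sum>X\<in>Pow I. of_real (q X) * cis (\<Sum>j\<in>X. u j / r)) ^ n)"
    proof
      fix u :: "nat \<Rightarrow> real"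
      have "of_real (pX m p X) * (\<Prod>j\<in>X. of_real (\<zeta> j) * cis (u j / r))
          = of_real P * (of_real (q X) * cis (\<Sum>j\<in>X. u j / r))" if "X \<in> Pow I" for X
      proof -
        have "finite X" using that I finite_subset by blast
        then have "(\<Prod>j\<in>X. of_real (\<zeta> j) * cis (u j / r)) = of_real (exp (\<Sum>j\<in>X. \<tau> j)) * cis (\<Sum>j\<in>X. u j / r)"
          by (simp add: prod.distrib zeta_def exp_sum cis_sum)
        then show ?thesis using P by (simp add: q_def)
      qed
      then have tilt: "(\<Sum>X\<in>Pow I. of_real (pX m p X) * (\<Prod>j\<in>X. of_real (\<zeta> j) * cis (u j / r)))
          = of_real P * (\<Sum>X\<in>Pow I. of_real (q X) * cis (\<Sum>j\<in>X. u j / r))"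
        unfolding sum_distrib_left by (rule sum.cong[OF refl])
      have "(\<Sum>vs\<in>{vs. length vs = n \<and> set vs \<subseteq> rankings m}.
          of_real (\<Prod>i<n. p (vs ! i)) * (\<Prod>j\<in>I. (of_real (\<zeta> j) * cis (u j / r)) ^ above_count m vs j))
        = (\<Sum>X\<in>Pow I. of_real (pX m p X) * (\<Prod>j\<in>X. of_real (\<zeta> j) * cis (u j / r))) ^ n"
        unfolding I_def by (rule sum_rankings_power[where x = "\<lambda>j. of_real (\<zeta> j) * cis (u j / r)"])
      then show "(\<Sum>vs\<in>{vs. length vs = n \<and> set vs \<subseteq> rankings m}.
          of_real (\<Prod>i<n. p (vs ! i)) * (\<Prod>j\<in>I. (of_real (\<zeta> j) * cis (u j / r)) ^ above_count m vs j))
        = of_real (P ^ n) * (\<Sum>X\<in>Pow I. of_real (q X) * cis (\<Sum>j\<in>X. u j / r)) ^ n"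
        unfolding tilt power_mult_distrib of_real_power .
    qed
    also have "(\<integral>u. of_real (P ^ n) * (\<Sum>X\<in>Pow I. of_real (q X) * cis (\<Sum>j\<in>X. u j / r)) ^ n *
       (\<Prod>j\<in>I. torus_kernel (\<zeta> j) (k n j) (u j / r)) \<partial>PiM I (\<lambda>_. lborel)) = of_real (P ^ n) * L n"
      unfolding L_def r_def mult.assoc by (rule integral_mult_right_zero)
    also have "(\<Prod>j\<in>I. complex_of_real (\<zeta> j powi (- k n j) / (2 * pi * r))) = of_real (1 / (W * (2 * pi * r) ^ d))"
    proof -
      have "(\<Prod>j\<in>I. \<zeta> j powi (- k n j) / (2 * pi * r)) = 1 / (W * (2 * pi * r) ^ d)"
        using prod_inversef[of "\<lambda>j. \<zeta> j powi k n j" I]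
        unfolding prod_dividef power_int_minus W_def prod_constant I(3)
        by (simp add: divide_inverse o_def)
      then show ?thesis unfolding of_real_prod[symmetric] by simp
    qed
    finally have prob: "complex_of_real (prob_winner m p \<alpha> n) = of_real (P ^ n / (W * (2 * pi * r) ^ d)) * L n"
      by simp
    have R: "R n = P ^ n / (Z * W) * (1 / sqrt ((2 * pi * real n) ^ d * D))"
      unfolding R_def P_def Z_def W_def k_def D_def d_def I_def by (simp add: prod.distrib)
    \<comment> \<open>Since \<open>2 * pi * n\<close> is the square of \<open>2 * pi * r\<close>
      divided by \<open>2 * pi\<close>, the root splits into the prefactor of the Fourier integral
      and the constant \<open>1 / (l * Z)\<close>.\<close>
    have "sqrt ((2 * pi * real n) ^ d * D) = sqrt ((2 * pi * r) ^ d * (2 * pi * r) ^ d * (D / (2 * pi) ^ d))"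
      unfolding r(2)[symmetric] by (simp add: power_mult_distrib field_simps)
    also have "\<dots> = (2 * pi * r) ^ d * sqrt (D / (2 * pi) ^ d)"
      using r unfolding real_sqrt_mult[of "(2 * pi * r) ^ d * (2 * pi * r) ^ d"] real_sqrt_mult_self by simp
    also have "sqrt (D / (2 * pi) ^ d) = 1 / (l * Z)"
      using Z by (simp add: l_def real_sqrt_divide)
    finally have "R n = P ^ n / (W * (2 * pi * r) ^ d) * l"
      unfolding R using Z by simp
    moreover define c where "c = P ^ n / (W * (2 * pi * r) ^ d)"
    ultimately have "R n = c * l" "complex_of_real (prob_winner m p \<alpha> n) = of_real c * L n"
      using prob by simp_all
    moreover have "c \<noteq> 0" using P W r by (simp add: c_def)
    ultimately show ?thesis by simp
  qed
  have "(\<lambda>n. L n / of_real l) \<longlonglongrightarrow> of_real l / of_real l"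
    using l by (intro tendsto_divide L_lim tendsto_const) auto
  then have "(\<lambda>n. L n / of_real l) \<longlonglongrightarrow> of_real 1" using l by simp
  then have "(\<lambda>n. complex_of_real (prob_winner m p \<alpha> n / R n)) \<longlonglongrightarrow> of_real 1"
    by (rule Lim_transform_eventually)
      (use ratio in \<open>auto intro: eventually_mono[OF eventually_gt_at_top[of 0]]\<close>)
  then have "(\<lambda>n. prob_winner m p \<alpha> n / R n) \<longlonglongrightarrow> 1"
    by (simp only: tendsto_of_real_iff)
  then show ?thesis unfolding R_def by (rule asymp_equivI')
qed

end
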